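(* Let $\mathbf p=(p_1,\dots,p_r)$ and $\mathbf q=(q_1,\dots,q_r)$ be probability distributions on $\mathcal X=\{c_1,\dots,c_r\}$ with $p_j>0$ and $q_j>0$ for all $j\in D$. Let $\widehat{\mathbf p}_n$ and $\widehat{\mathbf q}_m$ be the empirical distributions of i.i.d. samples $X_1,\dots,X_n$ from $\mathbf p$ and $Y_1,\dots,Y_m$ from $\mathbf q$. Then the following hold, where $\rightsquigarrow$ denotes convergence in distribution. (a) (One sample) As $n\to+\infty$, $$\sqrt n\,\bigl(\mathcal D_{KL}(\widehat{\mathbf p}_n,\mathbf q)-\mathcal D_{KL}(\mathbf p,\mathbf q)\bigr)\rightsquigarrow\mathcal N\bigl(0,V_{KL,1}(\mathbf p,\mathbf q)\bigr),\qquad\sqrt n\,\bigl(\mathcal D_{KL}(\mathbf p,\widehat{\mathbf q}_n)-\mathcal D_{KL}(\mathbf p,\mathbf q)\bigr)\rightsquigarrow\mathcal N\bigl(0,V_{KL,2}(\mathbf p,\mathbf q)\bigr).$$ (b) (Two samples) As $(n,m)\to(+\infty,+\infty)$ and $nm/(n+m)\to\gamma\in(0,1)$, $$\left(\frac{mn}{nV_{KL,2}(\mathbf p,\mathbf q)+mV_{KL,1}(\mathbf p,\mathbf q)}\right)^{1/2}\bigl(\mathcal D_{KL}(\widehat{\mathbf p}_n,\widehat{\mathbf q}_m)-\mathcal D_{KL}(\mathbf p,\mathbf q)\bigr)\rightsquigarrow\mathcal N(0,1).$$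
   Context: $\mathcal X=\{c_1,\dots,c_r\}$ with $r\ge 2$ is a finite set and $D=\{1,\dots,r\}$. A probability distribution $\mathbf p$ on $\mathcal X$ is identified with the vector $(p_1,\dots,p_r)$, $p_j$ being the mass of $c_j$. $X_1,X_2,\dots$ are i.i.d. with $\mathbb P(X_i=c_j)=p_j$, and $Y_1,Y_2,\dots$ are i.i.d. with $\mathbb P(Y_i=c_j)=q_j$; the two samples are independent of each other. Empirical probabilities: $\widehat p_n^{c_j}=\frac1n\sum_{i=1}^n 1_{\{X_i=c_j\}}$, $\widehat q_m^{c_j}=\frac1m\sum_{i=1}^m 1_{\{Y_i=c_j\}}$, $\widehat{\mathbf p}_n=(\widehat p_n^{c_j})_{j\in D}$, $\widehat{\mathbf q}_m=(\widehat q_m^{c_j})_{j\in D}$. Kullback-Leibler divergence: $\mathcal D_{KL}(\mathbf p,\mathbf q)=\sum_{j\in D}p_j\log(p_j/q_j)$ (natural logarithm). $$V_{KL,1}(\mathbf p,\mathbf q)=\sum_{j\in D}p_j(1-p_j)\bigl(1+\log(p_j/q_j)\bigr)^2-2\sum_{(i,j)\in D^2,\ i\neq j}p_ip_j\bigl(1+\log(p_i/q_i)\bigr)\bigl(1+\log(p_j/q_j)\bigr),$$ $$V_{KL,2}(\mathbf p,\mathbf q)=\sum_{j\in D}q_j(1-q_j)(p_j/q_j)^2-2\sum_{(i,j)\in D^2,\ i\neq j}p_ip_j.$$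
   Formalization: In both variances each pair i≠j is counted once (i<j), since the printed V_KL,2(p,p) is negative; in (b), nm/(n+m)→γ is impossible as n,m→∞, so n/(n+m)→γ is also treated, for p≠q (else the factor divides by 0). KL terms with an empirical q-cell equal to 0 count as 0. *)

theory Defs
  imports "HOL-Probability.Probability"
begin

text \<open>
  Distributions on \<open>{c 1, \<dots>, c r}\<close> are represented by their mass vectors, as functions
  \<open>nat \<Rightarrow> real\<close> of which only the values on \<open>{1..r}\<close> matter.
\<close>

definition prob_vector :: "nat \<Rightarrow> (nat \<Rightarrow> real) \<Rightarrow> bool" where
  "prob_vector r p \<longleftrightarrow> (\<forall>j\<in>{1..r}. 0 \<le> p j) \<and> (\<Sum>j\<in>{1..r}. p j) = 1"

definition iid_sample ::
    "'w measure \<Rightarrow> nat \<Rightarrow> (nat \<Rightarrow> 'a) \<Rightarrow> (nat \<Rightarrow> real) \<Rightarrow> (nat \<Rightarrow> 'w \<Rightarrow> 'a) \<Rightarrow> bool" where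
  "iid_sample M r c p X \<longleftrightarrow>
     prob_space.indep_vars M (\<lambda>_. count_space (c ` {1..r})) X {1..} \<and>
     (\<forall>i\<ge>1. \<forall>j\<in>{1..r}. measure M {\<omega> \<in> space M. X i \<omega> = c j} = p j)"

definition indep_samples ::
    "'w measure \<Rightarrow> nat \<Rightarrow> (nat \<Rightarrow> 'a) \<Rightarrow> (nat \<Rightarrow> 'w \<Rightarrow> 'a) \<Rightarrow> (nat \<Rightarrow> 'w \<Rightarrow> 'a) \<Rightarrow> bool" where
  "indep_samples M r c X Y \<longleftrightarrow>
     prob_space.indep_var M
       (\<Pi>\<^sub>M i\<in>{1..}. count_space (c ` {1..r})) (\<lambda>\<omega>. \<lambda>i\<in>{1..}. X i \<omega>)
       (\<Pi>\<^sub>M i\<in>{1..}. count_space (c ` {1..r})) (\<lambda>\<omega>. \<lambda>i\<in>{1..}. Y i \<omega>)"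

definition empirical :: "(nat \<Rightarrow> 'a) \<Rightarrow> (nat \<Rightarrow> 'w \<Rightarrow> 'a) \<Rightarrow> nat \<Rightarrow> 'w \<Rightarrow> nat \<Rightarrow> real" where
  "empirical c X n \<omega> j = (1 / real n) * (\<Sum>i=1..n. of_bool (X i \<omega> = c j))"

text \<open>
  A term with \<open>p j = 0\<close> vanishes, as in the usual convention. A term with \<open>q j = 0 < p j\<close>
  (usually \<open>\<infinity>\<close>) is \<open>0\<close> here because \<open>x / 0 = 0\<close> and \<open>ln 0 = 0\<close>. For an empirical \<open>q\<close>
  drawn from a distribution with full support this only concerns an event whose probability
  tends to \<open>0\<close>, so limits in distribution do not depend on the value chosen.
\<close>

definition KL_div :: "nat \<Rightarrow> (nat \<Rightarrow> real) \<Rightarrow> (nat \<Rightarrow> real) \<Rightarrow> real" where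
  "KL_div r p q = (\<Sum>j\<in>{1..r}. p j * ln (p j / q j))"

text \<open>
  The cross terms carry the factor \<open>2\<close>, so each pair of distinct indices has to be counted
  once, whence \<open>i < j\<close>: these are the variances of \<open>\<Sum>j. a j * Z j\<close> for \<open>Z\<close> centred Gaussian
  with the multinomial covariance, where \<open>a j = 1 + ln (p j / q j)\<close>, respectively
  \<open>a j = p j / q j\<close>. Summing over all ordered pairs would count every covariance twice, and
  would for instance make \<open>V_KL2 r p p\<close> negative.
\<close>

definition V_KL1 :: "nat \<Rightarrow> (nat \<Rightarrow> real) \<Rightarrow> (nat \<Rightarrow> real) \<Rightarrow> real" where
  "V_KL1 r p q =
     (\<Sum>j\<in>{1..r}. p j * (1 - p j) * (1 + ln (p j / q j))\<^sup>2)
     - 2 * (\<Sum>(i,j)\<in>{(i,j) \<in> {1..r} \<times> {1..r}. i < j}.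
              p i * p j * (1 + ln (p i / q i)) * (1 + ln (p j / q j)))"

definition V_KL2 :: "nat \<Rightarrow> (nat \<Rightarrow> real) \<Rightarrow> (nat \<Rightarrow> real) \<Rightarrow> real" where
  "V_KL2 r p q =
     (\<Sum>j\<in>{1..r}. q j * (1 - q j) * (p j / q j)\<^sup>2)
     - 2 * (\<Sum>(i,j)\<in>{(i,j) \<in> {1..r} \<times> {1..r}. i < j}. p i * p j)"

text \<open>
  The second argument is the variance. Variance \<open>0\<close> gives a point mass; it occurs below
  when \<open>p = q\<close>.
\<close>

definition normal_distribution :: "real \<Rightarrow> real \<Rightarrow> real measure" where
  "normal_distribution \<mu> v =
     (if v = 0 then return borel \<mu> else density lborel (normal_density \<mu> (sqrt v)))"

definition converges_in_distribution ::
    "'w measure \<Rightarrow> (nat \<Rightarrow> 'w \<Rightarrow> real) \<Rightarrow> real measure \<Rightarrow> bool" where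
  "converges_in_distribution M Z N \<longleftrightarrow> weak_conv_m (\<lambda>n. distr M borel (Z n)) N"

end

theory Submission
  imports Defs
begin

text \<open>
  The divergence is linearized at \<open>(p, q)\<close>: the remainder, truncated at \<open>1\<close>, is bounded by the
  squared distances of the empirical vectors from \<open>p\<close> and \<open>q\<close>, whose expectations are of order
  \<open>1 / n\<close> and \<open>1 / m\<close> and so survive multiplication by \<open>sqrt n\<close>. The linear part is a normalized
  sum of centred i.i.d. variables, to which the central limit theorem applies. Both are combined on
  the level of characteristic functions, where independence of the samples gives a product.
\<close>

section \<open>Quadratic remainder bound and the delta method\<close>

text \<open>The expansion is only local: a frequency of the second sample may be 0, where the
  logarithm takes a default value. Truncation makes the bound global, because such a vector stays at
  a fixed distance from \<open>q\<close> and is paid for by the squared distance. All three limits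
  come from one delta method; a vector that is not sampled is kept constant. With two samples the
  common scale is written both as \<open>\<alpha> k * sqrt (n k)\<close> and as
  \<open>\<beta> k * sqrt (m k)\<close>, and only the limits of \<alpha> and \<beta> enter the
  Gaussian law.

  The two-sample normalization divides by a combination of two variances that both vanish when
  \<open>p = q\<close>; for distinct \<open>p\<close> and \<open>q\<close> both are positive, by the
  equality case of nonnegativity of a variance. Since n m / (n + m) tends to infinity whenever n and
  m do, the premises of the third claim contradict each other; the limit with content is the fourth
  one, where n / (n + m) tends to \<gamma> and \<open>p\<close> differs from
  \<open>q\<close>.\<close>

lemma abs_x_ln_remainder_le:
  fixes x p :: real
  assumes "x \<ge> 0" "p > 0"
  shows "\<bar>x * ln (x / p) - (x - p)\<bar> \<le> (x - p)\<^sup>2 / p"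
proof (cases "x = 0")
  case True
  then show ?thesis using assms by (simp add: power2_eq_square)
next
  case False
  then have x: "x > 0" using assms by simp
  \<comment> \<open>The inequality \<open>ln t \<le> t - 1\<close> is used twice: at
    \<open>p / x\<close> it shows that the remainder is nonnegative, at \<open>x / p\<close> it
    gives the upper bound.\<close>
  have "ln (p / x) \<le> p / x - 1" using x assms by (intro ln_le_minus_one) auto
  then have "x * ln (p / x) \<le> x * (p / x - 1)" using x by (intro mult_left_mono) auto
  moreover have "ln (p / x) = - ln (x / p)" using x assms by (simp add: ln_div)
  moreover have "x * (p / x - 1) = p - x" using x by (simp add: field_simps)
  ultimately have lo: "x * ln (x / p) - (x - p) \<ge> 0" by simp
  have "ln (x / p) \<le> x / p - 1" using x assms by (intro ln_le_minus_one) auto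
  then have "x * ln (x / p) \<le> x * (x / p - 1)" using x by (intro mult_left_mono) auto
  moreover have "x * (x / p - 1) = (x - p)\<^sup>2 / p + (x - p)"
    using assms by (simp add: field_simps power2_eq_square)
  ultimately show ?thesis using lo by simp
qed

text \<open>Below 1, \<open>ln t \<le> t - 1\<close> at \<open>t = 1 / u\<close> gives
  \<open>- ln u \<le> (1 - u) / u\<close>, and the constant 2 bounds \<open>1 / u\<close>.\<close>

lemma abs_ln_le_twice_abs_diff:
  fixes u :: real
  assumes "u \<ge> 1/2"
  shows "\<bar>ln u\<bar> \<le> 2 * \<bar>u - 1\<bar>"
proof -
  have u: "u > 0" using assms by simp
  have up: "ln u \<le> u - 1" using u by (rule ln_le_minus_one)
  have "ln (1 / u) \<le> 1 / u - 1" using u by (intro ln_le_minus_one) auto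
  then have lo: "- ln u \<le> (1 - u) / u" using u by (simp add: ln_div field_simps)
  show ?thesis
  proof (cases "u \<ge> 1")
    case True then show ?thesis using up by simp
  next
    case False
    then have "(1 - u) / u \<le> (1 - u) / (1/2)" using assms by (intro divide_left_mono) auto
    moreover have "ln u \<le> 0" using False u by simp
    ultimately show ?thesis using lo False by (simp add: abs_if)
  qed
qed

text \<open>Again \<open>t = 1 / u\<close>: the remainder lies between 0 and
  \<open>(u - 1)\<^sup>2 / u\<close>, and \<open>1 / u\<close> is at most 2.\<close>

lemma abs_ln_remainder_le:
  fixes u :: real
  assumes "u \<ge> 1/2"
  shows "\<bar>u - 1 - ln u\<bar> \<le> 2 * (u - 1)\<^sup>2"
proof -
  have u: "u > 0" using assms by simp
  have up: "ln u \<le> u - 1" using u by (rule ln_le_minus_one)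
  have "ln (1 / u) \<le> 1 / u - 1" using u by (intro ln_le_minus_one) auto
  then have "u - 1 - ln u \<le> (u - 1)\<^sup>2 / u"
    using u by (simp add: ln_div field_simps power2_eq_square)
  also have "\<dots> \<le> (u - 1)\<^sup>2 / (1/2)" using assms by (intro divide_left_mono) auto
  finally show ?thesis using up by simp
qed

text \<open>The function \<open>x * ln (x / y)\<close> has partial derivatives
  \<open>1 + ln (p / q)\<close> and \<open>- (p / q)\<close> at \<open>(p, q)\<close>. With
  \<open>u = y / q\<close> the remainder splits into a part in x, a part in u and the mixed term
  \<open>(x - p) * ln u\<close>. The part in x contributes \<open>1 / p\<close>, the part in u
  contributes 2 because \<open>p \<le> 1\<close>, and the mixed term adds 1 to each
  coefficient.\<close>

lemma abs_KL_term_remainder_le: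
  fixes x y p q :: real
  assumes "x \<ge> 0" "y \<ge> q / 2" "0 < p" "p \<le> 1" "0 < q"
  shows "\<bar>x * ln (x / y) - p * ln (p / q) - (1 + ln (p / q)) * (x - p) + p / q * (y - q)\<bar>
    \<le> (1 / p + 1) * (x - p)\<^sup>2 + 3 / q\<^sup>2 * (y - q)\<^sup>2"
proof -
  define u where "u = y / q"
  have u: "u \<ge> 1/2" using assms by (simp add: u_def field_simps)
  have y: "y > 0" using assms by simp
  have id: "x * ln (x / y) - p * ln (p / q) - (1 + ln (p / q)) * (x - p) + p / q * (y - q)
     = (x * ln (x / p) - (x - p)) + p * (u - 1 - ln u) - (x - p) * ln u"
  \<comment> \<open>At \<open>x = 0\<close> the quotient rule for \<open>ln\<close> fails, but every
    logarithm of a quotient with numerator x is multiplied by 0.\<close>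
  proof (cases "x = 0")
    case True
    then show ?thesis using assms y by (simp add: u_def field_simps)
  next
    case False
    then show ?thesis using assms y by (simp add: u_def ln_div field_simps)
  qed
  have 1: "\<bar>x * ln (x / p) - (x - p)\<bar> \<le> (x - p)\<^sup>2 / p"
    using assms by (intro abs_x_ln_remainder_le)
  have "p * \<bar>u - 1 - ln u\<bar> \<le> 1 * (2 * (u - 1)\<^sup>2)"
    using assms u by (intro mult_mono abs_ln_remainder_le) auto
  then have 2: "\<bar>p * (u - 1 - ln u)\<bar> \<le> 2 * (u - 1)\<^sup>2" using assms by (simp add: abs_mult)
  have "\<bar>x - p\<bar> * \<bar>ln u\<bar> \<le> \<bar>x - p\<bar> * (2 * \<bar>u - 1\<bar>)"
    using u by (intro mult_left_mono abs_ln_le_twice_abs_diff) auto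
  \<comment> \<open>Expanding this square gives \<open>2 a b \<le> a\<^sup>2 + b\<^sup>2\<close>,
    which separates the mixed term.\<close>
  moreover have "0 \<le> (\<bar>x - p\<bar> - \<bar>u - 1\<bar>)\<^sup>2" by simp
  ultimately have 3: "\<bar>(x - p) * ln u\<bar> \<le> (x - p)\<^sup>2 + (u - 1)\<^sup>2"
    by (simp add: abs_mult power2_diff)
  have 4: "3 / q\<^sup>2 * (y - q)\<^sup>2 = 3 * (u - 1)\<^sup>2"
    using assms by (simp add: u_def field_simps power2_eq_square)
  have "(1 / p + 1) * (x - p)\<^sup>2 = (x - p)\<^sup>2 / p + (x - p)\<^sup>2"
    by (simp add: field_simps)
  then show ?thesis unfolding id 4 using 1 2 3 by linarith
qed

text \<open>With \<open>a\<close> the vector of partial derivatives at \<open>p\<close>, this is the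
  differential applied to the displacement \<open>x - p\<close>.\<close>

definition wsum :: "nat \<Rightarrow> (nat \<Rightarrow> real) \<Rightarrow> (nat \<Rightarrow> real) \<Rightarrow> (nat \<Rightarrow> real) \<Rightarrow> real" where
  "wsum r a x p = (\<Sum>j\<in>{1..r}. a j * (x j - p j))"

text \<open>
  An estimate \<open>y j\<close> below \<open>q j / 2\<close>, where the logarithm is out of control, already makes the
  right-hand side at least \<open>1\<close>. So truncating at \<open>1\<close> gives a quadratic bound on all of space.
\<close>

lemma min_KL_remainder_le:
  fixes p q x y :: "nat \<Rightarrow> real" and s :: real
  assumes p: "\<And>j. j \<in> {1..r} \<Longrightarrow> 0 < p j \<and> p j \<le> 1"
    and q: "\<And>j. j \<in> {1..r} \<Longrightarrow> 0 < q j"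
    and x: "\<And>j. j \<in> {1..r} \<Longrightarrow> 0 \<le> x j" and s: "s \<ge> 0"
  defines "R \<equiv> KL_div r x y - KL_div r p q
     - (wsum r (\<lambda>j. 1 + ln (p j / q j)) x p + wsum r (\<lambda>j. - (p j / q j)) y q)"
    and "C \<equiv> (\<Sum>j\<in>{1..r}. 1 / p j + 1 + 4 / (q j)\<^sup>2)"
  shows "min 1 (s * \<bar>R\<bar>)
    \<le> (1 + s) * (C * (\<Sum>j\<in>{1..r}. (x j - p j)\<^sup>2 + (y j - q j)\<^sup>2))"
proof -
  define E where "E = (\<Sum>j\<in>{1..r}. (x j - p j)\<^sup>2 + (y j - q j)\<^sup>2)"
  define K where "K j = 1 / p j + 1 + 4 / (q j)\<^sup>2" for j
  have K0: "0 \<le> K j" if "j \<in> {1..r}" for j using p[OF that] by (simp add: K_def)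
  have KC: "K j \<le> C" if "j \<in> {1..r}" for j
    unfolding C_def K_def[symmetric] using that K0 by (intro member_le_sum) auto
  have C0: "0 \<le> C" unfolding C_def K_def[symmetric] using K0 by (intro sum_nonneg)
  have E0: "0 \<le> E" unfolding E_def by (intro sum_nonneg) simp
  show ?thesis
  proof (cases "\<exists>j\<in>{1..r}. y j < q j / 2")
    case True
    then obtain j where j: "j \<in> {1..r}" "y j < q j / 2" by auto
    note qj = q[OF j(1)]
    \<comment> \<open>The 4 in \<open>C\<close> originates here: a deviation of at least
      \<open>q j / 2\<close> makes \<open>4 / (q j)\<^sup>2 * (y j - q j)\<^sup>2\<close> at least
      1. It also dominates the 3 of the regular case.\<close>
    have "(q j / 2)\<^sup>2 \<le> (q j - y j)\<^sup>2" using j qj by (intro power_mono) auto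
    then have "1 \<le> 4 / (q j)\<^sup>2 * (y j - q j)\<^sup>2"
      using qj by (simp add: field_simps power2_eq_square)
    also have "\<dots> \<le> K j * ((x j - p j)\<^sup>2 + (y j - q j)\<^sup>2)"
      using p[OF j(1)] by (intro mult_mono) (auto simp: K_def)
    also have "\<dots> \<le> C * E"
      using j C0 KC by (intro mult_mono) (auto simp: E_def intro!: member_le_sum)
    finally have "1 \<le> C * E" .
    \<comment> \<open>In the factor \<open>1 + s\<close> the summand 1 pays for the truncated case,
      and s for the scaled quadratic bound of the other case.\<close>
    moreover have "0 \<le> s * (C * E)" using s C0 E0 by simp
    ultimately show ?thesis unfolding E_def[symmetric] by (simp add: distrib_right)
  next
    case False
    have Req: "R = (\<Sum>j\<in>{1..r}. x j * ln (x j / y j) - p j * ln (p j / q j)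
        - (1 + ln (p j / q j)) * (x j - p j) + p j / q j * (y j - q j))"
      by (simp add: R_def KL_div_def wsum_def sum.distrib sum_subtractf sum_negf)
    have "\<bar>R\<bar> \<le> (\<Sum>j\<in>{1..r}. C * ((x j - p j)\<^sup>2 + (y j - q j)\<^sup>2))"
      unfolding Req
    proof (rule order_trans[OF sum_abs sum_mono])
      fix j assume j: "j \<in> {1..r}"
      have "\<bar>x j * ln (x j / y j) - p j * ln (p j / q j)
        - (1 + ln (p j / q j)) * (x j - p j) + p j / q j * (y j - q j)\<bar>
        \<le> (1 / p j + 1) * (x j - p j)\<^sup>2 + 3 / (q j)\<^sup>2 * (y j - q j)\<^sup>2"
        using p[OF j] q[OF j] x[OF j] False j
        by (intro abs_KL_term_remainder_le) (auto simp: not_less)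
      also have "\<dots> \<le> K j * (x j - p j)\<^sup>2 + K j * (y j - q j)\<^sup>2"
      proof (intro add_mono mult_right_mono)
        have "3 / (q j)\<^sup>2 \<le> 4 / (q j)\<^sup>2" by (intro divide_right_mono) auto
        then show "3 / (q j)\<^sup>2 \<le> K j" using p[OF j] by (simp add: K_def add_increasing)
      qed (auto simp: K_def)
      also have "\<dots> \<le> C * ((x j - p j)\<^sup>2 + (y j - q j)\<^sup>2)"
        unfolding distrib_left[symmetric] using KC[OF j] by (intro mult_right_mono) auto
      finally show "\<bar>x j * ln (x j / y j) - p j * ln (p j / q j)
        - (1 + ln (p j / q j)) * (x j - p j) + p j / q j * (y j - q j)\<bar>
        \<le> C * ((x j - p j)\<^sup>2 + (y j - q j)\<^sup>2)" .
    qed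
    then have "\<bar>R\<bar> \<le> C * E" by (simp add: E_def sum_distrib_left)
    then have "s * \<bar>R\<bar> \<le> s * (C * E)" using s by (intro mult_left_mono)
    moreover have "0 \<le> C * E" using C0 E0 by simp
    ultimately have "min 1 (s * \<bar>R\<bar>) \<le> (1 + s) * (C * E)" by (simp add: distrib_right)
    then show ?thesis unfolding E_def .
  qed
qed

text \<open>Factoring out a unimodular number leaves \<open>iexp d - 1\<close> with
  \<open>d = t * (a - b)\<close>, of modulus at most 2 and at most the modulus of d. The first bound
  serves when a and b are more than 1 apart, the second otherwise.\<close>

lemma norm_iexp_diff_le:
  "cmod (iexp (t * a) - iexp (t * b)) \<le> (2 + \<bar>t\<bar>) * min 1 \<bar>a - b\<bar>"
proof -
  define d where "d = t * (a - b)"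
  have "iexp (t * a) - iexp (t * b) = iexp (t * b) * (iexp d - 1)"
    by (simp add: d_def algebra_simps flip: exp_add)
  then have eq: "cmod (iexp (t * a) - iexp (t * b)) = cmod (iexp d - 1)"
    by (simp add: norm_mult)
  have 1: "cmod (iexp d - 1) \<le> \<bar>t\<bar> * \<bar>a - b\<bar>"
    using iexp_approx1[of d 0] by (simp add: d_def abs_mult)
  have 2: "cmod (iexp d - 1) \<le> 2"
    using iexp_approx2[of d 0] by simp
  show ?thesis
  proof (cases "\<bar>a - b\<bar> \<le> 1")
    case True
    have "\<bar>t\<bar> * \<bar>a - b\<bar> \<le> (2 + \<bar>t\<bar>) * \<bar>a - b\<bar>" by (intro mult_right_mono) auto
    with True show ?thesis unfolding eq using 1 by simp
  next
    case False
    then show ?thesis unfolding eq using 2 by simp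
  qed
qed

section \<open>Slutsky's lemma and the delta method for the divergence\<close>

context prob_space
begin

text \<open>The truncated mean distance bounds the gap between the two characteristic functions at
  each t, so both have the same limit, and Levy's continuity theorem returns to laws.\<close>

lemma slutsky:
  fixes Z S :: "nat \<Rightarrow> 'a \<Rightarrow> real"
  assumes [measurable]: "\<And>k. Z k \<in> borel_measurable M" "\<And>k. S k \<in> borel_measurable M"
    and N: "real_distribution N"
    and S: "\<And>t. (\<lambda>k. char (distr M borel (S k)) t) \<longlonglongrightarrow> char N t"
    and Z: "(\<lambda>k. expectation (\<lambda>\<omega>. min 1 \<bar>Z k \<omega> - S k \<omega>\<bar>)) \<longlonglongrightarrow> 0"
  shows "converges_in_distribution M Z N"
  unfolding converges_in_distribution_def
proof (rule levy_continuity[OF _ N])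
  fix t
  have int: "integrable M (\<lambda>\<omega>. iexp (t * f \<omega>))"
    if [measurable]: "f \<in> borel_measurable M" for f
    by (rule integrable_const_bound[where B = 1]) auto
  have "cmod (char (distr M borel (Z k)) t - char (distr M borel (S k)) t)
      \<le> (2 + \<bar>t\<bar>) * expectation (\<lambda>\<omega>. min 1 \<bar>Z k \<omega> - S k \<omega>\<bar>)" for k
  proof -
    have "char (distr M borel (Z k)) t - char (distr M borel (S k)) t
      = (CLINT \<omega>|M. iexp (t * Z k \<omega>) - iexp (t * S k \<omega>))"
      unfolding char_def by (simp add: integral_distr int del: of_real_mult)
    also have "cmod \<dots> \<le> (LINT \<omega>|M. cmod (iexp (t * Z k \<omega>) - iexp (t * S k \<omega>)))"
      by (rule integral_norm_bound)
    also have "\<dots> \<le> (LINT \<omega>|M. (2 + \<bar>t\<bar>) * min 1 \<bar>Z k \<omega> - S k \<omega>\<bar>)"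
    proof (rule integral_mono)
      show "integrable M (\<lambda>\<omega>. cmod (iexp (t * Z k \<omega>) - iexp (t * S k \<omega>)))"
        by (intro integrable_norm Bochner_Integration.integrable_diff int) auto
      show "integrable M (\<lambda>\<omega>. (2 + \<bar>t\<bar>) * min 1 \<bar>Z k \<omega> - S k \<omega>\<bar>)"
        by (intro integrable_mult_right integrable_const_bound[where B = 1]) auto
    qed (rule norm_iexp_diff_le)
    finally show ?thesis by simp
  qed
  moreover have "(\<lambda>k. (2 + \<bar>t\<bar>) * expectation (\<lambda>\<omega>. min 1 \<bar>Z k \<omega> - S k \<omega>\<bar>)) \<longlonglongrightarrow> 0"
    using tendsto_mult_left[OF Z, of "2 + \<bar>t\<bar>"] by simp
  ultimately have "(\<lambda>k. char (distr M borel (Z k)) t - char (distr M borel (S k)) t) \<longlonglongrightarrow> 0"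
    by (rule Lim_null_comparison[OF always_eventually, OF allI])
  then show "(\<lambda>k. char (distr M borel (Z k)) t) \<longlonglongrightarrow> char N t"
    by (rule Lim_transform[OF S])
qed (rule real_distribution_distr, simp)

text \<open>The variable \<open>S\<close> is kept apart from the scaled differential
  \<open>s k * L k\<close> because with two samples the coefficients merely converge:
  \<open>S\<close> then carries their limits, at a vanishing cost in mean. The premise
  \<open>lim\<close> is the rate at which the quadratic remainder must be beaten.\<close>

lemma KL_div_delta_method:
  fixes P Q :: "nat \<Rightarrow> 'a \<Rightarrow> nat \<Rightarrow> real" and S :: "nat \<Rightarrow> 'a \<Rightarrow> real" and s :: "nat \<Rightarrow> real"
  assumes p: "\<And>j. j \<in> {1..r} \<Longrightarrow> 0 < p j \<and> p j \<le> 1"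
    and q: "\<And>j. j \<in> {1..r} \<Longrightarrow> 0 < q j"
    and P[measurable]: "\<And>k j. (\<lambda>\<omega>. P k \<omega> j) \<in> borel_measurable M"
    and P0: "\<And>k \<omega> j. j \<in> {1..r} \<Longrightarrow> P k \<omega> j \<ge> 0"
    and Q[measurable]: "\<And>k j. (\<lambda>\<omega>. Q k \<omega> j) \<in> borel_measurable M"
    and s: "\<And>k. 0 \<le> s k"
    and iP: "\<And>k j. integrable M (\<lambda>\<omega>. (P k \<omega> j - p j)\<^sup>2)"
    and iQ: "\<And>k j. integrable M (\<lambda>\<omega>. (Q k \<omega> j - q j)\<^sup>2)"
    and lim: "(\<lambda>k. (1 + s k) * expectation (\<lambda>\<omega>. \<Sum>j\<in>{1..r}. (P k \<omega> j - p j)\<^sup>2 + (Q k \<omega> j - q j)\<^sup>2))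
       \<longlonglongrightarrow> 0"
    and S[measurable]: "\<And>k. S k \<in> borel_measurable M"
  defines "L k \<omega> \<equiv> wsum r (\<lambda>j. 1 + ln (p j / q j)) (P k \<omega>) p + wsum r (\<lambda>j. - (p j / q j)) (Q k \<omega>) q"
  assumes iS: "\<And>k. integrable M (\<lambda>\<omega>. s k * L k \<omega> - S k \<omega>)"
    and LS: "(\<lambda>k. expectation (\<lambda>\<omega>. \<bar>s k * L k \<omega> - S k \<omega>\<bar>)) \<longlonglongrightarrow> 0"
    and N: "real_distribution N"
    and char_S: "\<And>t. (\<lambda>k. char (distr M borel (S k)) t) \<longlonglongrightarrow> char N t"
  shows "converges_in_distribution M (\<lambda>k \<omega>. s k * (KL_div r (P k \<omega>) (Q k \<omega>) - KL_div r p q)) N"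
proof -
  define Z where "Z k \<omega> = s k * (KL_div r (P k \<omega>) (Q k \<omega>) - KL_div r p q)" for k \<omega>
  define E where "E k \<omega> = (\<Sum>j\<in>{1..r}. (P k \<omega> j - p j)\<^sup>2 + (Q k \<omega> j - q j)\<^sup>2)" for k \<omega>
  define C where "C = (\<Sum>j\<in>{1..r}. 1 / p j + 1 + 4 / (q j)\<^sup>2)"
  have Z_meas[measurable]: "Z k \<in> borel_measurable M" for k
    unfolding Z_def[abs_def] KL_div_def by measurable
  have iE: "integrable M (E k)" for k
    unfolding E_def[abs_def] by (intro Bochner_Integration.integrable_sum Bochner_Integration.integrable_add iP iQ)
  \<comment> \<open>The scaled differential is inserted between \<open>Z\<close> and
    \<open>S\<close>; only its distance to \<open>Z\<close> needs the truncation.\<close>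
  have pw: "min 1 \<bar>Z k \<omega> - S k \<omega>\<bar> \<le> (1 + s k) * (C * E k \<omega>) + \<bar>s k * L k \<omega> - S k \<omega>\<bar>" for k \<omega>
  proof -
    have "min 1 (s k * \<bar>KL_div r (P k \<omega>) (Q k \<omega>) - KL_div r p q - L k \<omega>\<bar>)
        \<le> (1 + s k) * (C * E k \<omega>)"
      unfolding L_def C_def E_def using p q P0 s by (intro min_KL_remainder_le) auto
    moreover have "s k * \<bar>KL_div r (P k \<omega>) (Q k \<omega>) - KL_div r p q - L k \<omega>\<bar> = \<bar>Z k \<omega> - s k * L k \<omega>\<bar>"
      using s[of k] by (simp add: Z_def abs_mult flip: right_diff_distrib)
    ultimately show ?thesis by linarith
  qed
  have up: "expectation (\<lambda>\<omega>. min 1 \<bar>Z k \<omega> - S k \<omega>\<bar>)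
      \<le> C * ((1 + s k) * expectation (E k)) + expectation (\<lambda>\<omega>. \<bar>s k * L k \<omega> - S k \<omega>\<bar>)" for k
  proof -
    have "expectation (\<lambda>\<omega>. min 1 \<bar>Z k \<omega> - S k \<omega>\<bar>)
        \<le> expectation (\<lambda>\<omega>. (1 + s k) * (C * E k \<omega>) + \<bar>s k * L k \<omega> - S k \<omega>\<bar>)"
      by (intro integral_mono pw Bochner_Integration.integrable_add integrable_mult_right integrable_abs iE iS
            integrable_const_bound[where B = 1]) auto
    also have "\<dots> = expectation (\<lambda>\<omega>. (1 + s k) * (C * E k \<omega>)) + expectation (\<lambda>\<omega>. \<bar>s k * L k \<omega> - S k \<omega>\<bar>)"
      by (intro Bochner_Integration.integral_add integrable_mult_right integrable_abs iE iS)
    finally show ?thesis by (simp add: mult_ac)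
  qed
  have "(\<lambda>k. expectation (\<lambda>\<omega>. min 1 \<bar>Z k \<omega> - S k \<omega>\<bar>)) \<longlonglongrightarrow> 0"
  proof (rule tendsto_sandwich[OF _ _ tendsto_const])
    show "\<forall>\<^sub>F k in sequentially. 0 \<le> expectation (\<lambda>\<omega>. min 1 \<bar>Z k \<omega> - S k \<omega>\<bar>)"
      by (intro always_eventually allI Bochner_Integration.integral_nonneg) auto
    show "\<forall>\<^sub>F k in sequentially. expectation (\<lambda>\<omega>. min 1 \<bar>Z k \<omega> - S k \<omega>\<bar>)
      \<le> C * ((1 + s k) * expectation (E k)) + expectation (\<lambda>\<omega>. \<bar>s k * L k \<omega> - S k \<omega>\<bar>)"
      using up by (intro always_eventually) auto
    show "(\<lambda>k. C * ((1 + s k) * expectation (E k)) + expectation (\<lambda>\<omega>. \<bar>s k * L k \<omega> - S k \<omega>\<bar>)) \<longlonglongrightarrow> 0"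
      using tendsto_add[OF tendsto_mult_left[OF lim, of C] LS] by (simp add: E_def[abs_def])
  qed
  then have "converges_in_distribution M Z N"
    by (rule slutsky[OF Z_meas S N char_S])
  then show ?thesis unfolding Z_def .
qed

end

section \<open>Variances\<close>

text \<open>The variance of \<open>\<Sum>j. a j * N j\<close> for \<open>N\<close> multinomial with one trial and weights \<open>p\<close>.\<close>

definition mvar :: "nat \<Rightarrow> (nat \<Rightarrow> real) \<Rightarrow> (nat \<Rightarrow> real) \<Rightarrow> real" where
  "mvar r p a = (\<Sum>j\<in>{1..r}. p j * (a j)\<^sup>2) - (\<Sum>j\<in>{1..r}. p j * a j)\<^sup>2"

lemma sum_square_eq_diagonal_plus_pairs:
  fixes f :: "nat \<Rightarrow> real"
  shows "(\<Sum>j\<in>{1..r}. f j)\<^sup>2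
    = (\<Sum>j\<in>{1..r}. (f j)\<^sup>2) + 2 * (\<Sum>(i,j)\<in>{(i,j) \<in> {1..r} \<times> {1..r}. i < j}. f i * f j)"
proof (induction r)
  case 0
  then show ?case by simp
next
  case (Suc r)
  let ?P = "\<lambda>r. {(i,j) \<in> {1..r} \<times> {1..r}. i < j}"
  have eq: "?P (Suc r) = ?P r \<union> (\<lambda>i. (i, Suc r)) ` {1..r}"
    by auto
  have fin: "finite (?P r)"
    by (rule finite_subset[of _ "{1..r} \<times> {1..r}"]) auto
  have "(\<Sum>(i,j)\<in>?P (Suc r). f i * f j)
      = (\<Sum>(i,j)\<in>?P r. f i * f j) + (\<Sum>(i,j)\<in>(\<lambda>i. (i, Suc r)) ` {1..r}. f i * f j)"
    unfolding eq using fin by (intro sum.union_disjoint) auto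
  also have "(\<Sum>(i,j)\<in>(\<lambda>i. (i, Suc r)) ` {1..r}. f i * f j) = (\<Sum>i\<in>{1..r}. f i) * f (Suc r)"
    by (subst sum.reindex) (auto simp: inj_on_def sum_distrib_right)
  finally show ?case using Suc.IH by (simp add: power2_sum algebra_simps)
qed

text \<open>The diagonal of the squared mean turns the weight \<open>p j\<close> into
  \<open>p j * (1 - p j)\<close>; its off-diagonal part counts each unordered pair twice, whence the
  factor 2.\<close>

lemma mvar_eq_pairs:
  "mvar r p a = (\<Sum>j\<in>{1..r}. p j * (1 - p j) * (a j)\<^sup>2)
     - 2 * (\<Sum>(i,j)\<in>{(i,j) \<in> {1..r} \<times> {1..r}. i < j}. p i * p j * a i * a j)"
proof -
  have "(\<Sum>j\<in>{1..r}. p j * a j)\<^sup>2 = (\<Sum>j\<in>{1..r}. (p j * a j)\<^sup>2)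
    + 2 * (\<Sum>(i,j)\<in>{(i,j) \<in> {1..r} \<times> {1..r}. i < j}. p i * a i * (p j * a j))"
    by (rule sum_square_eq_diagonal_plus_pairs)
  then show ?thesis
    by (simp add: mvar_def sum_subtractf algebra_simps power2_eq_square)
qed

lemma V_KL1_eq_mvar: "V_KL1 r p q = mvar r p (\<lambda>j. 1 + ln (p j / q j))"
  unfolding V_KL1_def mvar_eq_pairs by simp

text \<open>The minus sign is that of the derivative in the second argument. It cancels in squares
  and products, and the weights \<open>q i * q j\<close> cancel the denominators.\<close>

lemma V_KL2_eq_mvar:
  assumes "\<forall>j\<in>{1..r}. q j > 0"
  shows "V_KL2 r p q = mvar r q (\<lambda>j. - (p j / q j))"
proof -
  have "(\<Sum>(i,j)\<in>{(i,j) \<in> {1..r} \<times> {1..r}. i < j}. q i * q j * - (p i / q i) * - (p j / q j))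
     = (\<Sum>(i,j)\<in>{(i,j) \<in> {1..r} \<times> {1..r}. i < j}. p i * p j)"
  proof (intro sum.cong refl, clarify)
    fix i j assume ij: "i \<in> {1..r}" "j \<in> {1..r}"
    then have "q i > 0" "q j > 0" using assms by blast+
    then show "q i * q j * - (p i / q i) * - (p j / q j) = p i * p j" by simp
  qed
  then show ?thesis unfolding V_KL2_def mvar_eq_pairs by simp
qed

text \<open>Because the weights sum to 1, centring at the mean exhibits the variance as a sum of
  nonnegative terms, from which both its sign and its vanishing case can be read off.\<close>

lemma mvar_eq_centred:
  assumes "prob_vector r p"
  shows "mvar r p a = (\<Sum>j\<in>{1..r}. p j * (a j - (\<Sum>i\<in>{1..r}. p i * a i))\<^sup>2)"
proof -
  define \<mu> where "\<mu> = (\<Sum>i\<in>{1..r}. p i * a i)"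
  have "(\<Sum>j\<in>{1..r}. p j * (a j - \<mu>)\<^sup>2)
    = (\<Sum>j\<in>{1..r}. p j * (a j)\<^sup>2 - 2 * \<mu> * (p j * a j) + \<mu>\<^sup>2 * p j)"
    by (intro sum.cong) (auto simp: power2_eq_square algebra_simps)
  also have "\<dots> = (\<Sum>j\<in>{1..r}. p j * (a j)\<^sup>2) - 2 * \<mu> * \<mu> + \<mu>\<^sup>2 * (\<Sum>j\<in>{1..r}. p j)"
    by (simp add: sum.distrib sum_subtractf sum_distrib_left \<mu>_def)
  also have "\<dots> = mvar r p a"
    using assms by (simp add: prob_vector_def mvar_def \<mu>_def power2_eq_square)
  finally show ?thesis by (simp add: \<mu>_def)
qed

lemma mvar_nonneg:
  assumes "prob_vector r p"
  shows "mvar r p a \<ge> 0"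
  unfolding mvar_eq_centred[OF assms] using assms
  by (intro sum_nonneg) (auto simp: prob_vector_def)

lemma mvar_eq_0_imp_constant:
  assumes p: "prob_vector r p" "\<forall>j\<in>{1..r}. p j > 0" and "mvar r p a = 0"
  obtains \<kappa> where "\<And>j. j \<in> {1..r} \<Longrightarrow> a j = \<kappa>"
proof -
  have "(\<Sum>j\<in>{1..r}. p j * (a j - (\<Sum>i\<in>{1..r}. p i * a i))\<^sup>2) = 0"
    using assms(3) mvar_eq_centred[OF p(1)] by simp
  then have "\<forall>j\<in>{1..r}. p j * (a j - (\<Sum>i\<in>{1..r}. p i * a i))\<^sup>2 = 0"
    using p by (subst (asm) sum_nonneg_eq_0_iff) (auto simp: prob_vector_def)
  then have "a j = (\<Sum>i\<in>{1..r}. p i * a i)" if "j \<in> {1..r}" for j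
    using p(2) that by fastforce
  then show thesis by (rule that)
qed

text \<open>Summing \<open>p i = \<kappa> * q i\<close> over all indices forces
  \<open>\<kappa> = 1\<close>.\<close>

lemma prob_vectors_proportional_imp_eq:
  assumes "prob_vector r p" "prob_vector r q" "\<forall>j\<in>{1..r}. q j > 0"
    and "\<And>j. j \<in> {1..r} \<Longrightarrow> p j / q j = \<kappa>" and "j \<in> {1..r}"
  shows "p j = q j"
proof -
  have eq: "p i = \<kappa> * q i" if "i \<in> {1..r}" for i
  proof -
    have "q i > 0" using assms(3) that by blast
    then show ?thesis using assms(4)[OF that] by (simp add: field_simps)
  qed
  have "1 = (\<Sum>i\<in>{1..r}. \<kappa> * q i)" using assms(1) eq by (simp add: prob_vector_def)
  also have "\<dots> = \<kappa>" using assms(2) by (simp add: prob_vector_def flip: sum_distrib_left)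
  finally show ?thesis using eq assms(5) by simp
qed

text \<open>A vanishing variance would make \<open>1 + ln (p j / q j)\<close> constant, hence
  \<open>p\<close> proportional to \<open>q\<close> and so equal to it. Positivity is what makes the
  two-sample normalization meaningful.\<close>

lemma V_KL1_pos:
  assumes "prob_vector r p" "prob_vector r q" "\<forall>j\<in>{1..r}. p j > 0" "\<forall>j\<in>{1..r}. q j > 0"
    and "\<exists>j\<in>{1..r}. p j \<noteq> q j"
  shows "V_KL1 r p q > 0"
proof (rule ccontr)
  assume "\<not> V_KL1 r p q > 0"
  then have "mvar r p (\<lambda>j. 1 + ln (p j / q j)) = 0"
    using mvar_nonneg[OF assms(1)] by (simp add: V_KL1_eq_mvar order_antisym)
  then obtain \<kappa> where "\<And>j. j \<in> {1..r} \<Longrightarrow> 1 + ln (p j / q j) = \<kappa>"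
    by (rule mvar_eq_0_imp_constant[OF assms(1,3)]) blast
  then have "p j / q j = exp (\<kappa> - 1)" if "j \<in> {1..r}" for j
    using that assms(3,4) by (metis add_diff_cancel_left' divide_pos_pos exp_ln)
  then show False using prob_vectors_proportional_imp_eq[OF assms(1,2,4)] assms(5) by blast
qed

lemma V_KL2_pos:
  assumes "prob_vector r p" "prob_vector r q" "\<forall>j\<in>{1..r}. q j > 0"
    and "\<exists>j\<in>{1..r}. p j \<noteq> q j"
  shows "V_KL2 r p q > 0"
proof (rule ccontr)
  assume "\<not> V_KL2 r p q > 0"
  then have "mvar r q (\<lambda>j. - (p j / q j)) = 0"
    using mvar_nonneg[OF assms(2)] assms(3) by (simp add: V_KL2_eq_mvar order_antisym)
  then obtain \<kappa> where "\<And>j. j \<in> {1..r} \<Longrightarrow> - (p j / q j) = \<kappa>"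
    by (rule mvar_eq_0_imp_constant[OF assms(2,3)]) blast
  then have "p j / q j = - \<kappa>" if "j \<in> {1..r}" for j
    using that by fastforce
  then show False using prob_vectors_proportional_imp_eq[OF assms(1-3)] assms(4) by blast
qed

section \<open>Centred normal laws, the degenerate one included\<close>

lemma normal_distribution_eq_distr:
  assumes "v \<ge> 0"
  shows "normal_distribution 0 v = distr std_normal_distribution borel (\<lambda>x. sqrt v * x)"
proof (cases "v = 0")
  case True
  interpret prob_space std_normal_distribution by (rule prob_space_normal_density) simp
  \<comment> \<open>Scaling by 0 collapses the standard normal law to the point mass at 0, so the
    pushforward description also covers variance 0.\<close>
  show ?thesis using True distr_const[of 0 borel] by (simp add: normal_distribution_def)
next
  case False
  interpret prob_space std_normal_distribution by (rule prob_space_normal_density) simp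
  have "distributed std_normal_distribution lborel (\<lambda>x. x) std_normal_density"
    by (auto simp: distributed_def intro!: distr_id2)
  note affine = normal_density_affine[OF this, of "sqrt v" 0]
  have "distr std_normal_distribution lborel (\<lambda>x. sqrt v * x) = normal_distribution 0 v"
    using affine False assms by (simp add: distributed_def normal_distribution_def)
  moreover have "distr std_normal_distribution borel (\<lambda>x. sqrt v * x)
      = distr std_normal_distribution lborel (\<lambda>x. sqrt v * x)"
    by (rule distr_cong) auto
  ultimately show ?thesis by simp
qed

lemma real_distribution_normal_distribution:
  assumes "v \<ge> 0"
  shows "real_distribution (normal_distribution 0 v)"
proof -
  interpret prob_space std_normal_distribution by (rule prob_space_normal_density) simp
  show ?thesis unfolding normal_distribution_eq_distr[OF assms]
    by (intro real_distribution_distr) simp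
qed

lemma char_distr_scale:
  assumes [measurable]: "Z \<in> borel_measurable M"
  shows "char (distr M borel (\<lambda>\<omega>. a * Z \<omega>)) t = char (distr M borel Z) (a * t)"
  by (simp add: char_def integral_distr mult_ac)

lemma char_normal_distribution:
  assumes "v \<ge> 0"
  shows "char (normal_distribution 0 v) t = of_real (exp (- (v * t\<^sup>2) / 2))"
proof -
  have "char (normal_distribution 0 v) t = char (distr std_normal_distribution borel (\<lambda>x. x)) (sqrt v * t)"
    unfolding normal_distribution_eq_distr[OF assms] by (rule char_distr_scale) simp
  also have "distr std_normal_distribution borel (\<lambda>x. x) = std_normal_distribution"
    by (rule distr_id2) simp
  also have "char std_normal_distribution (sqrt v * t) = of_real (exp (- ((sqrt v * t)\<^sup>2) / 2))"
    by (simp only: char_std_normal_distribution)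
  also have "(sqrt v * t)\<^sup>2 = v * t\<^sup>2" using assms by (simp add: power_mult_distrib)
  finally show ?thesis .
qed

section \<open>Empirical measures\<close>

lemma empirical_nonneg: "0 \<le> empirical c X n \<omega> j"
  unfolding empirical_def by (intro mult_nonneg_nonneg sum_nonneg) auto

lemma empirical_le_1: "empirical c X n \<omega> j \<le> 1"
proof -
  have "(\<Sum>i=1..n. of_bool (X i \<omega> = c j)) \<le> (\<Sum>i=1..n. 1::real)"
    by (intro sum_mono) auto
  then show ?thesis by (cases "n = 0") (auto simp: empirical_def)
qed

lemma abs_empirical_diff_le: "\<bar>empirical c X n \<omega> j - b\<bar> \<le> 1 + \<bar>b\<bar>"
  using empirical_nonneg[of c X n \<omega> j] empirical_le_1[of c X n \<omega> j] by (simp add: abs_if)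

lemma abs_wsum_empirical_le:
  "\<bar>wsum r a (empirical c X n \<omega>) p\<bar> \<le> (\<Sum>j\<in>{1..r}. \<bar>a j\<bar> * (1 + \<bar>p j\<bar>))"
  unfolding wsum_def
  by (rule order_trans[OF sum_abs sum_mono])
    (auto simp: abs_mult intro: mult_left_mono abs_empirical_diff_le)

text \<open>The influence of one observation on the linear term: its value at \<open>c j\<close> is
  \<open>a j\<close> minus the mean of \<open>a\<close> under \<open>p\<close>.\<close>

definition score :: "nat \<Rightarrow> (nat \<Rightarrow> 'a) \<Rightarrow> (nat \<Rightarrow> real) \<Rightarrow> (nat \<Rightarrow> real) \<Rightarrow> 'a \<Rightarrow> real" where
  "score r c a p x = (\<Sum>j\<in>{1..r}. a j * (of_bool (x = c j) - p j))"

text \<open>The case \<open>n = 0\<close> is excluded because the empirical vector is then 0 by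
  division by zero: the left side would be minus the mean of \<open>a\<close>, the right side
  0.\<close>

lemma wsum_empirical_eq_score:
  assumes "n \<ge> 1"
  shows "wsum r a (empirical c X n \<omega>) p = (\<Sum>i=1..n. score r c a p (X i \<omega>)) / real n"
proof -
  have "(\<Sum>i=1..n. score r c a p (X i \<omega>))
    = (\<Sum>j\<in>{1..r}. \<Sum>i=1..n. a j * (of_bool (X i \<omega> = c j) - p j))"
    unfolding score_def by (rule sum.swap)
  also have "\<dots> = (\<Sum>j\<in>{1..r}. real n * (a j * (empirical c X n \<omega> j - p j)))"
    using assms
    by (intro sum.cong refl) (simp add: empirical_def sum_subtractf algebra_simps flip: sum_distrib_left)
  also have "\<dots> = real n * wsum r a (empirical c X n \<omega>) p"
    by (simp add: wsum_def sum_distrib_left)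
  finally show ?thesis using assms by simp
qed

text \<open>Choosing a unit vector as coefficients lets the second moment of \<open>wsum\<close>
  yield the mean squared error of a single frequency.\<close>

lemma wsum_single:
  assumes "j \<in> {1..r}"
  shows "wsum r (\<lambda>k. of_bool (k = j)) x p = x j - p j"
proof -
  have "wsum r (\<lambda>k. of_bool (k = j)) x p = (\<Sum>k\<in>{1..r}. if k = j then x k - p k else 0)"
    unfolding wsum_def by (intro sum.cong) auto
  then show ?thesis using assms by simp
qed

lemma score_at:
  assumes "inj_on c {1..r}" "j \<in> {1..r}"
  shows "score r c a p (c j) = a j - (\<Sum>k\<in>{1..r}. p k * a k)"
proof -
  have "(\<Sum>k\<in>{1..r}. a k * of_bool (c j = c k)) = (\<Sum>k\<in>{1..r}. if k = j then a k else 0)"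
    using assms by (intro sum.cong) (auto simp: inj_on_eq_iff)
  also have "\<dots> = a j" using assms by simp
  finally show ?thesis by (simp add: score_def right_diff_distrib sum_subtractf mult.commute)
qed

text \<open>Samples are indexed from 1, whereas the central limit theorem takes all natural numbers
  as indices; with \<open>f = Suc\<close> this carries independence across the shift.\<close>

lemma (in prob_space) indep_vars_reindex:
  assumes f: "inj_on f I" and X: "indep_vars N X (f ` I)"
  shows "indep_vars (\<lambda>i. N (f i)) (\<lambda>i. X (f i)) I"
proof -
  let ?F = "\<lambda>i. {X i -` A \<inter> space M |A. A \<in> sets (N i)}"
  have meas: "\<forall>i\<in>f ` I. random_variable (N i) (X i)" and sets: "indep_sets ?F (f ` I)"
    using X by (auto simp: indep_vars_def2)
  have "indep_sets (\<lambda>i. ?F (f i)) I"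
  proof (rule indep_setsI)
    show "?F (f i) \<subseteq> events" if "i \<in> I" for i
      using sets that by (auto simp: indep_sets_def)
  next
    fix A J assume J: "J \<noteq> {}" "J \<subseteq> I" "finite J" and A: "\<forall>j\<in>J. A j \<in> ?F (f j)"
    define B where "B = A \<circ> the_inv_into J f"
    have inj: "inj_on f J" using f J(2) by (rule inj_on_subset)
    have B: "B (f j) = A j" if "j \<in> J" for j
      using that by (simp add: B_def the_inv_into_f_f[OF inj])
    have "prob (\<Inter>j\<in>f ` J. B j) = (\<Prod>j\<in>f ` J. prob (B j))"
      using J A B by (intro indep_setsD[OF sets]) auto
    then show "prob (\<Inter>j\<in>J. A j) = (\<Prod>j\<in>J. prob (A j))"
      using B by (simp add: prod.reindex[OF inj])
  qed
  then show ?thesis using meas by (auto simp: indep_vars_def2)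
qed

section \<open>A single sample: moments, common law and central limit theorem\<close>

locale discrete_sample = prob_space M for M :: "'w measure" +
  fixes r :: nat and c :: "nat \<Rightarrow> 'a" and p :: "nat \<Rightarrow> real" and X :: "nat \<Rightarrow> 'w \<Rightarrow> 'a"
  assumes inj: "inj_on c {1..r}" and p: "prob_vector r p" and iid: "iid_sample M r c p X"
begin

lemma indep: "indep_vars (\<lambda>_. count_space (c ` {1..r})) X {1..}"
  using iid by (simp add: iid_sample_def)

lemma sample_measurable[measurable]:
  assumes "i \<ge> 1"
  shows "X i \<in> measurable M (count_space (c ` {1..r}))"
  using indep assms by (simp add: indep_vars_def2)

lemma function_measurable:
  assumes "i \<ge> 1"
  shows "(\<lambda>\<omega>. g (X i \<omega>)) \<in> borel_measurable M"
  using measurable_compose[OF sample_measurable[OF assms], of g borel] by simp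

text \<open>An observation takes only the values \<open>c j\<close>, so any function of it is a
  finite combination of indicators; this reduces expectations to the masses
  \<open>p j\<close>.\<close>

lemma function_eq_sum_indicator:
  fixes g :: "'a \<Rightarrow> real"
  assumes "i \<ge> 1" "\<omega> \<in> space M"
  shows "g (X i \<omega>) = (\<Sum>j\<in>{1..r}. g (c j) * indicator {\<omega> \<in> space M. X i \<omega> = c j} \<omega>)"
proof -
  obtain j where j: "j \<in> {1..r}" "X i \<omega> = c j"
    using measurable_space[OF sample_measurable[OF assms(1)] assms(2)] by auto
  have "(\<Sum>k\<in>{1..r}. g (c k) * indicator {\<omega> \<in> space M. X i \<omega> = c k} \<omega>)
      = (\<Sum>k\<in>{1..r}. if k = j then g (c k) else 0)"
    using j inj assms by (intro sum.cong) (auto simp: inj_on_eq_iff)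
  then show ?thesis using j by simp
qed

lemma event_measurable:
  assumes "i \<ge> 1"
  shows "{\<omega> \<in> space M. X i \<omega> = c j} \<in> sets M"
proof -
  have "Measurable.pred M (\<lambda>\<omega>. X i \<omega> = c j)"
    using measurable_compose[OF sample_measurable[OF assms], of "\<lambda>x. x = c j" "count_space UNIV"]
    by simp
  then show ?thesis by (simp add: pred_def)
qed

lemma
  fixes g :: "'a \<Rightarrow> real"
  assumes i: "i \<ge> 1"
  shows integrable_function: "integrable M (\<lambda>\<omega>. g (X i \<omega>))"
    and expectation_function: "expectation (\<lambda>\<omega>. g (X i \<omega>)) = (\<Sum>j\<in>{1..r}. p j * g (c j))"
proof -
  let ?f = "\<lambda>\<omega>. \<Sum>j\<in>{1..r}. g (c j) * indicator {\<omega> \<in> space M. X i \<omega> = c j} \<omega>"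
  have int: "integrable M (\<lambda>\<omega>. g (c j) * indicator {\<omega> \<in> space M. X i \<omega> = c j} \<omega>)" for j
    using event_measurable[OF i]
    by (intro integrable_mult_right integrable_real_indicator) (auto simp: emeasure_eq_measure)
  have "integrable M ?f" by (intro Bochner_Integration.integrable_sum int)
  moreover have "integrable M (\<lambda>\<omega>. g (X i \<omega>)) = integrable M ?f"
    by (rule Bochner_Integration.integrable_cong[OF refl function_eq_sum_indicator[OF i]])
  ultimately show "integrable M (\<lambda>\<omega>. g (X i \<omega>))" by simp
  have "expectation (\<lambda>\<omega>. g (X i \<omega>)) = expectation ?f"
    by (intro Bochner_Integration.integral_cong refl function_eq_sum_indicator[OF i])
  also have "\<dots> = (\<Sum>j\<in>{1..r}. expectation (\<lambda>\<omega>. g (c j) * indicator {\<omega> \<in> space M. X i \<omega> = c j} \<omega>))"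
    by (intro Bochner_Integration.integral_sum int)
  also have "\<dots> = (\<Sum>j\<in>{1..r}. p j * g (c j))"
  proof (intro sum.cong refl)
    fix j assume "j \<in> {1..r}"
    then have "measure M {\<omega> \<in> space M. X i \<omega> = c j} = p j"
      using iid i by (simp add: iid_sample_def)
    then show "expectation (\<lambda>\<omega>. g (c j) * indicator {\<omega> \<in> space M. X i \<omega> = c j} \<omega>) = p j * g (c j)"
      using event_measurable[OF i, of j] by (simp add: Int_absorb2 sets.sets_into_space mult.commute)
  qed
  finally show "expectation (\<lambda>\<omega>. g (X i \<omega>)) = (\<Sum>j\<in>{1..r}. p j * g (c j))" .
qed

lemma expectation_score:
  assumes "i \<ge> 1"
  shows "expectation (\<lambda>\<omega>. score r c a p (X i \<omega>)) = 0"
proof -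
  have "(\<Sum>j\<in>{1..r}. p j * score r c a p (c j))
    = (\<Sum>j\<in>{1..r}. p j * a j - p j * (\<Sum>k\<in>{1..r}. p k * a k))"
    by (intro sum.cong refl) (simp add: score_at[OF inj] right_diff_distrib)
  also have "\<dots> = (\<Sum>j\<in>{1..r}. p j * a j) - (\<Sum>j\<in>{1..r}. p j) * (\<Sum>k\<in>{1..r}. p k * a k)"
    by (simp add: sum_subtractf sum_distrib_right)
  also have "\<dots> = 0" using p by (simp add: prob_vector_def)
  finally show ?thesis unfolding expectation_function[OF assms] .
qed

lemma expectation_score_square:
  assumes "i \<ge> 1"
  shows "expectation (\<lambda>\<omega>. (score r c a p (X i \<omega>))\<^sup>2) = mvar r p a"
  using expectation_function[OF assms, of "\<lambda>x. (score r c a p x)\<^sup>2"]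
  by (simp add: mvar_eq_centred[OF p] score_at[OF inj])

text \<open>A law on a finite set is determined by its point masses, which are the
  \<open>p j\<close> for every index. This supplies the identical distributions in the central limit
  theorem.\<close>

lemma distr_function_eq:
  fixes g :: "'a \<Rightarrow> real"
  assumes i: "i \<ge> 1"
  shows "distr M borel (\<lambda>\<omega>. g (X i \<omega>)) = distr M borel (\<lambda>\<omega>. g (X 1 \<omega>))"
proof -
  let ?C = "count_space (c ` {1..r})"
  have meas: "emeasure (distr M ?C (X k)) {c j} = ennreal (p j)" if "k \<ge> 1" "j \<in> {1..r}" for k j
  proof -
    have "emeasure (distr M ?C (X k)) {c j} = emeasure M (X k -` {c j} \<inter> space M)"
      using that by (intro emeasure_distr sample_measurable) auto
    also have "X k -` {c j} \<inter> space M = {\<omega> \<in> space M. X k \<omega> = c j}" by auto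
    also have "emeasure M \<dots> = ennreal (p j)"
      using iid that by (simp add: emeasure_eq_measure iid_sample_def)
    finally show ?thesis .
  qed
  have "distr M ?C (X i) = distr M ?C (X 1)"
    by (rule measure_eqI_finite[of _ "c ` {1..r}"]) (use i meas in auto)
  moreover have "distr M borel (\<lambda>\<omega>. g (X k \<omega>)) = distr (distr M ?C (X k)) borel g" if "k \<ge> 1" for k
    using that by (subst distr_distr[OF _ sample_measurable]) (auto simp: comp_def)
  ultimately show ?thesis using i by simp
qed

lemma indep_score: "indep_vars (\<lambda>_. borel) (\<lambda>i \<omega>. score r c a p (X i \<omega>)) {1..}"
  by (rule indep_vars_compose2[OF indep]) auto

text \<open>The next score is independent of the preceding sum and has mean 0, so the cross term
  vanishes and variances add. Integrability is part of the induction because expanding the square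
  relies on it.\<close>

lemma expectation_score_sum_square:
  "integrable M (\<lambda>\<omega>. (\<Sum>i=1..n. score r c a p (X i \<omega>))\<^sup>2) \<and>
   expectation (\<lambda>\<omega>. (\<Sum>i=1..n. score r c a p (X i \<omega>))\<^sup>2) = real n * mvar r p a"
proof (induction n)
  case 0
  then show ?case by simp
next
  case (Suc n)
  define \<xi> where "\<xi> i \<omega> = score r c a p (X i \<omega>)" for i \<omega>
  define S where "S \<omega> = (\<Sum>i=1..n. \<xi> i \<omega>)" for \<omega>
  have i\<xi>: "integrable M (\<xi> i)" if "i \<ge> 1" for i
    unfolding \<xi>_def[abs_def] by (rule integrable_function[OF that])
  have iS: "integrable M S" unfolding S_def[abs_def] by (intro Bochner_Integration.integrable_sum i\<xi>) auto
  have ind: "indep_var borel (\<xi> (Suc n)) borel S"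
    unfolding S_def[abs_def] \<xi>_def[abs_def]
    by (rule indep_vars_sum[of "{1..n}" "Suc n" "\<lambda>i \<omega>. score r c a p (X i \<omega>)"])
      (auto intro: indep_vars_subset[OF indep_score])
  have iprod: "integrable M (\<lambda>\<omega>. \<xi> (Suc n) \<omega> * S \<omega>)"
    by (rule indep_var_integrable[OF ind i\<xi> iS]) simp
  have "expectation (\<lambda>\<omega>. \<xi> (Suc n) \<omega> * S \<omega>) = expectation (\<xi> (Suc n)) * expectation S"
    by (rule indep_var_lebesgue_integral[OF ind i\<xi> iS]) simp
  then have prod0: "expectation (\<lambda>\<omega>. \<xi> (Suc n) \<omega> * S \<omega>) = 0"
    using expectation_score[of "Suc n" a] by (simp add: \<xi>_def[abs_def])
  have i2: "integrable M (\<lambda>\<omega>. (\<xi> (Suc n) \<omega>)\<^sup>2)"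
    unfolding \<xi>_def by (rule integrable_function[where g = "\<lambda>x. (score r c a p x)\<^sup>2"]) simp
  have iS2: "integrable M (\<lambda>\<omega>. (S \<omega>)\<^sup>2)" and eS2: "expectation (\<lambda>\<omega>. (S \<omega>)\<^sup>2) = real n * mvar r p a"
    using Suc.IH by (simp_all add: S_def \<xi>_def)
  have eq: "(\<Sum>i=1..Suc n. score r c a p (X i \<omega>))\<^sup>2
      = (S \<omega>)\<^sup>2 + (\<xi> (Suc n) \<omega>)\<^sup>2 + 2 * (\<xi> (Suc n) \<omega> * S \<omega>)" for \<omega>
    by (simp add: S_def \<xi>_def power2_sum mult_ac)
  have e2: "expectation (\<lambda>\<omega>. (\<xi> (Suc n) \<omega>)\<^sup>2) = mvar r p a"
    unfolding \<xi>_def by (rule expectation_score_square) simp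
  show ?case unfolding eq
    using iS2 i2 iprod eS2 e2 prod0 by (simp add: distrib_right)
qed

lemma empirical_measurable[measurable]: "(\<lambda>\<omega>. empirical c X n \<omega> j) \<in> borel_measurable M"
  unfolding empirical_def
  by (intro borel_measurable_times borel_measurable_sum borel_measurable_const function_measurable) auto

lemma wsum_empirical_measurable[measurable]:
  "(\<lambda>\<omega>. wsum r a (empirical c X n \<omega>) b) \<in> borel_measurable M"
  unfolding wsum_def
  by (intro borel_measurable_times borel_measurable_sum borel_measurable_diff borel_measurable_const
      empirical_measurable)

lemma integrable_wsum_empirical: "integrable M (\<lambda>\<omega>. wsum r a (empirical c X n \<omega>) b)"
proof (rule integrable_const_bound)
  show "AE \<omega> in M. norm (wsum r a (empirical c X n \<omega>) b) \<le> (\<Sum>j\<in>{1..r}. \<bar>a j\<bar> * (1 + \<bar>b j\<bar>))"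
    using abs_wsum_empirical_le[of r a c X n _ b] by simp
qed (rule wsum_empirical_measurable)

lemma integrable_wsum_empirical_square: "integrable M (\<lambda>\<omega>. (wsum r a (empirical c X n \<omega>) b)\<^sup>2)"
proof (rule integrable_const_bound)
  show "AE \<omega> in M. norm ((wsum r a (empirical c X n \<omega>) b)\<^sup>2) \<le> (\<Sum>j\<in>{1..r}. \<bar>a j\<bar> * (1 + \<bar>b j\<bar>))\<^sup>2"
    using power_mono[OF abs_wsum_empirical_le[of r a c X n _ b], where n = 2] by simp
qed (intro borel_measurable_power wsum_empirical_measurable)

lemma expectation_wsum_empirical_square:
  assumes "n \<ge> 1"
  shows "expectation (\<lambda>\<omega>. (wsum r a (empirical c X n \<omega>) p)\<^sup>2) = mvar r p a / real n"
proof -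
  have "expectation (\<lambda>\<omega>. (wsum r a (empirical c X n \<omega>) p)\<^sup>2)
      = expectation (\<lambda>\<omega>. (\<Sum>i=1..n. score r c a p (X i \<omega>))\<^sup>2) / (real n)\<^sup>2"
    by (simp add: wsum_empirical_eq_score[OF assms] power_divide)
  also have "\<dots> = real n * mvar r p a / (real n)\<^sup>2"
    using expectation_score_sum_square[of a n] by simp
  finally show ?thesis using assms by (simp add: power2_eq_square)
qed

lemma integrable_empirical_square: "integrable M (\<lambda>\<omega>. (empirical c X n \<omega> j - b)\<^sup>2)"
proof (rule integrable_const_bound)
  show "AE \<omega> in M. norm ((empirical c X n \<omega> j - b)\<^sup>2) \<le> (1 + \<bar>b\<bar>)\<^sup>2"
    using power_mono[OF abs_empirical_diff_le[of c X n _ j b], where n = 2] by simp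
qed (intro borel_measurable_power borel_measurable_diff borel_measurable_const empirical_measurable)

lemma expectation_empirical_sq_dist:
  assumes "n \<ge> 1"
  shows "expectation (\<lambda>\<omega>. \<Sum>j\<in>{1..r}. (empirical c X n \<omega> j - p j)\<^sup>2)
    = (\<Sum>j\<in>{1..r}. mvar r p (\<lambda>k. of_bool (k = j))) / real n"
proof -
  have "expectation (\<lambda>\<omega>. \<Sum>j\<in>{1..r}. (empirical c X n \<omega> j - p j)\<^sup>2)
    = (\<Sum>j\<in>{1..r}. expectation (\<lambda>\<omega>. (empirical c X n \<omega> j - p j)\<^sup>2))"
    by (intro Bochner_Integration.integral_sum integrable_empirical_square)
  also have "\<dots> = (\<Sum>j\<in>{1..r}. mvar r p (\<lambda>k. of_bool (k = j)) / real n)"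
  proof (intro sum.cong refl)
    fix j assume j: "j \<in> {1..r}"
    show "expectation (\<lambda>\<omega>. (empirical c X n \<omega> j - p j)\<^sup>2) = mvar r p (\<lambda>k. of_bool (k = j)) / real n"
      using expectation_wsum_empirical_square[OF assms, of "\<lambda>k. of_bool (k = j)"]
      unfolding wsum_single[OF j] .
  qed
  finally show ?thesis by (simp add: sum_divide_distrib)
qed

text \<open>The central limit theorem requires positive variance. If the variance is 0, the linear
  term has second moment 0 for \<open>n \<ge> 1\<close>, so it vanishes almost surely and its
  characteristic function is 1, like that of the point mass.\<close>

lemma char_wsum_empirical:
  "(\<lambda>n. char (distr M borel (\<lambda>\<omega>. sqrt (real n) * wsum r a (empirical c X n \<omega>) p)) t)
    \<longlonglongrightarrow> char (normal_distribution 0 (mvar r p a)) t"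
proof -
  define V where "V = mvar r p a"
  have V: "V \<ge> 0" unfolding V_def by (rule mvar_nonneg[OF p])
  define W where "W n \<omega> = wsum r a (empirical c X n \<omega>) p" for n \<omega>
  have W_meas[measurable]: "W n \<in> borel_measurable M" for n
    unfolding W_def[abs_def] by measurable
  show ?thesis
  proof (cases "V = 0")
    case True
    have "char (distr M borel (\<lambda>\<omega>. sqrt (real n) * W n \<omega>)) t = 1" if n: "n \<ge> 1" for n
    proof -
      have "integrable M (\<lambda>\<omega>. (W n \<omega>)\<^sup>2)"
        unfolding W_def by (rule integrable_wsum_empirical_square)
      moreover have "expectation (\<lambda>\<omega>. (W n \<omega>)\<^sup>2) = 0"
        using True expectation_wsum_empirical_square[OF n, of a] by (simp add: W_def V_def)
      ultimately have "AE \<omega> in M. (W n \<omega>)\<^sup>2 = 0"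
        by (subst (asm) integral_nonneg_eq_0_iff_AE) auto
      then have "(CLINT \<omega>|M. iexp (t * (sqrt (real n) * W n \<omega>))) = (CLINT \<omega>|M. 1)"
        by (intro integral_cong_AE) (auto elim: eventually_mono)
      then show ?thesis by (simp add: char_def integral_distr prob_space)
    qed
    then have "(\<lambda>n. char (distr M borel (\<lambda>\<omega>. sqrt (real n) * W n \<omega>)) t) \<longlonglongrightarrow> 1"
      by (intro tendsto_eventually eventually_sequentiallyI[of 1])
    moreover have "char (normal_distribution 0 V) t = 1"
      using char_normal_distribution[of V t] True by simp
    ultimately show ?thesis by (simp add: W_def V_def)
  next
    case False
    \<comment> \<open>The shift by \<open>Suc\<close> matches the first observation
      \<open>X 1\<close> with index 0.\<close>
    define \<xi> where "\<xi> i \<omega> = score r c a p (X (Suc i) \<omega>)" for i \<omega>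
    have int: "integrable M (\<lambda>\<omega>. (\<xi> i \<omega>)\<^sup>2)" for i
      unfolding \<xi>_def by (rule integrable_function[where g = "\<lambda>x. (score r c a p x)\<^sup>2"]) simp
    have mean: "expectation (\<xi> i) = 0" for i
      unfolding \<xi>_def[abs_def] by (rule expectation_score) simp
    have "weak_conv_m (\<lambda>n. distr M borel (\<lambda>\<omega>. (\<Sum>i<n. \<xi> i \<omega>) / sqrt (real n * (sqrt V)\<^sup>2)))
        std_normal_distribution"
    proof (rule central_limit_theorem_zero_mean)
      show "indep_vars (\<lambda>i. borel) \<xi> UNIV"
        unfolding \<xi>_def[abs_def]
        by (rule indep_vars_reindex[where X = "\<lambda>i \<omega>. score r c a p (X i \<omega>)" and f = Suc])
          (auto intro: indep_vars_subset[OF indep_score])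
      show "variance (\<xi> i) = (sqrt V)\<^sup>2" for i
        using expectation_score_square[of "Suc i" a] V by (simp add: mean) (simp add: \<xi>_def V_def)
      show "distr M borel (\<xi> i) = distr M borel (\<xi> 0)" for i
        using distr_function_eq[of "Suc i" "score r c a p"] by (simp add: \<xi>_def[abs_def])
    qed (use False V int mean in auto)
    \<comment> \<open>Passing from variance 1 to variance \<open>V\<close> amounts to evaluating the
      characteristic functions at \<open>sqrt V * t\<close>.\<close>
    then have lim: "(\<lambda>n. char (distr M borel (\<lambda>\<omega>. (\<Sum>i<n. \<xi> i \<omega>) / sqrt (real n * (sqrt V)\<^sup>2))) (sqrt V * t))
        \<longlonglongrightarrow> char std_normal_distribution (sqrt V * t)"
    proof (rule levy_continuity1[rotated 2])
      have [measurable]: "\<xi> i \<in> borel_measurable M" for i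
        unfolding \<xi>_def[abs_def] by (rule function_measurable) simp
      show "real_distribution (distr M borel (\<lambda>\<omega>. (\<Sum>i<n. \<xi> i \<omega>) / sqrt (real n * (sqrt V)\<^sup>2)))" for n
        by (rule real_distribution_distr) measurable
    qed (rule real_dist_normal_dist)
    have eq: "sqrt (real n) * W n \<omega> = sqrt V * ((\<Sum>i<n. \<xi> i \<omega>) / sqrt (real n * (sqrt V)\<^sup>2))" for n \<omega>
    proof (cases "n = 0")
      case True then show ?thesis by simp
    next
      case n: False
      have "(\<Sum>i<n. \<xi> i \<omega>) = (\<Sum>i=1..n. score r c a p (X i \<omega>))"
        unfolding \<xi>_def by (rule sum.reindex_bij_witness[of _ "\<lambda>i. i - 1" Suc]) auto
      then have "W n \<omega> = (\<Sum>i<n. \<xi> i \<omega>) / real n"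
        using n by (simp add: W_def wsum_empirical_eq_score)
      then have "sqrt (real n) * W n \<omega> = (\<Sum>i<n. \<xi> i \<omega>) / sqrt (real n)"
        using sqrt_divide_self_eq[of "real n"] by (simp add: divide_inverse mult_ac)
      moreover have "sqrt (real n * (sqrt V)\<^sup>2) = sqrt V * sqrt (real n)"
        using V by (simp add: real_sqrt_mult)
      ultimately show ?thesis using False by simp
    qed
    have char_eq: "char (distr M borel (\<lambda>\<omega>. sqrt (real n) * W n \<omega>)) t
      = char (distr M borel (\<lambda>\<omega>. (\<Sum>i<n. \<xi> i \<omega>) / sqrt (real n * (sqrt V)\<^sup>2))) (sqrt V * t)" for n
      unfolding eq
    proof (rule char_distr_scale)
      have [measurable]: "\<xi> i \<in> borel_measurable M" for i
        unfolding \<xi>_def[abs_def] by (rule function_measurable) simp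
      show "(\<lambda>\<omega>. (\<Sum>i<n. \<xi> i \<omega>) / sqrt (real n * (sqrt V)\<^sup>2)) \<in> borel_measurable M"
        by measurable
    qed
    have char_lim: "char std_normal_distribution (sqrt V * t) = char (normal_distribution 0 V) t"
    proof -
      have "char std_normal_distribution (sqrt V * t) = of_real (exp (- ((sqrt V * t)\<^sup>2) / 2))"
        by (simp only: char_std_normal_distribution)
      also have "(sqrt V * t)\<^sup>2 = V * t\<^sup>2" using V by (simp add: power_mult_distrib)
      finally show ?thesis using char_normal_distribution[OF V] by simp
    qed
    show ?thesis
      using lim unfolding char_eq[symmetric] char_lim unfolding W_def V_def .
  qed
qed

text \<open>The bound of \<open>\<bar>x\<bar>\<close> by \<open>1 + x\<^sup>2\<close> turns the
  exact second moment into a first-moment bound uniform in n, which is what makes replacing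
  converging coefficients by their limits harmless.\<close>

lemma expectation_abs_scaled_wsum_le:
  "expectation (\<lambda>\<omega>. \<bar>sqrt (real n) * wsum r a (empirical c X n \<omega>) p\<bar>) \<le> 1 + mvar r p a"
proof -
  let ?W = "\<lambda>\<omega>. wsum r a (empirical c X n \<omega>) p"
  have bound: "\<bar>x\<bar> \<le> 1 + x\<^sup>2" for x :: real
    using zero_le_power2[of "\<bar>x\<bar> - 1"] by (simp add: power2_diff)
  have "expectation (\<lambda>\<omega>. \<bar>sqrt (real n) * ?W \<omega>\<bar>) \<le> expectation (\<lambda>\<omega>. 1 + real n * (?W \<omega>)\<^sup>2)"
  proof (rule integral_mono)
    show "integrable M (\<lambda>\<omega>. \<bar>sqrt (real n) * ?W \<omega>\<bar>)"
      by (intro integrable_abs integrable_mult_right integrable_wsum_empirical)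
    show "integrable M (\<lambda>\<omega>. 1 + real n * (?W \<omega>)\<^sup>2)"
      by (intro Bochner_Integration.integrable_add integrable_mult_right integrable_wsum_empirical_square
          integrable_const)
    show "\<bar>sqrt (real n) * ?W \<omega>\<bar> \<le> 1 + real n * (?W \<omega>)\<^sup>2" for \<omega>
      using bound[of "sqrt (real n) * ?W \<omega>"] by (simp add: power_mult_distrib)
  qed
  also have "\<dots> = 1 + real n * expectation (\<lambda>\<omega>. (?W \<omega>)\<^sup>2)"
    using integrable_wsum_empirical_square[of a n p] by (simp add: prob_space)
  also have "\<dots> \<le> 1 + mvar r p a"
    using expectation_wsum_empirical_square[of n a] mvar_nonneg[OF p, of a] by (cases "n = 0") auto
  finally show ?thesis .
qed

text \<open>The expected squared distance is a constant over \<open>n k\<close>, so the product is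
  of order \<open>1 / n k\<close> plus \<open>\<alpha> k / sqrt (n k)\<close>. The sequence
  \<open>n\<close> and the converging factor \<alpha> make the result fit both samples of the
  two-sample limit.\<close>

lemma scaled_empirical_sq_dist_tendsto_0:
  fixes n :: "nat \<Rightarrow> nat"
  assumes n: "filterlim n at_top sequentially" and \<alpha>: "\<alpha> \<longlonglongrightarrow> a"
  shows "(\<lambda>k. (1 + \<alpha> k * sqrt (real (n k)))
      * expectation (\<lambda>\<omega>. \<Sum>j\<in>{1..r}. (empirical c X (n k) \<omega> j - p j)\<^sup>2)) \<longlonglongrightarrow> 0"
proof -
  define w where "w = (\<Sum>j\<in>{1..r}. mvar r p (\<lambda>k. of_bool (k = j)))"
  have n': "filterlim (\<lambda>k. real (n k)) at_top sequentially"
    by (rule filterlim_compose[OF filterlim_real_sequentially n])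
  have "(\<lambda>k. inverse (real (n k))) \<longlonglongrightarrow> 0"
    by (rule tendsto_inverse_0_at_top[OF n'])
  moreover have "(\<lambda>k. inverse (sqrt (real (n k)))) \<longlonglongrightarrow> 0"
    by (rule tendsto_inverse_0_at_top[OF filterlim_compose[OF sqrt_at_top n']])
  ultimately have lim: "(\<lambda>k. w * (inverse (real (n k)) + \<alpha> k * inverse (sqrt (real (n k))))) \<longlonglongrightarrow> w * (0 + a * 0)"
    by (intro tendsto_intros \<alpha>)
  have "eventually (\<lambda>k. n k \<ge> 1) sequentially"
    using n by (simp add: filterlim_at_top)
  then have "eventually (\<lambda>k. w * (inverse (real (n k)) + \<alpha> k * inverse (sqrt (real (n k))))
    = (1 + \<alpha> k * sqrt (real (n k)))
      * expectation (\<lambda>\<omega>. \<Sum>j\<in>{1..r}. (empirical c X (n k) \<omega> j - p j)\<^sup>2)) sequentially"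
  proof eventually_elim
    case (elim k)
    have "sqrt (real (n k)) / real (n k) = inverse (sqrt (real (n k)))"
      by (rule sqrt_divide_self_eq) simp
    then show ?case
      unfolding expectation_empirical_sq_dist[OF elim] w_def[symmetric]
      by (simp add: divide_inverse algebra_simps)
  qed
  then show ?thesis using lim by (auto elim: Lim_transform_eventually)
qed

end

section \<open>Limit theorems for the divergence\<close>

lemma wsum_self: "wsum r a q q = 0"
  by (simp add: wsum_def)

lemma prob_vector_le_1:
  assumes "prob_vector r p" "j \<in> {1..r}"
  shows "p j \<le> 1"
proof -
  have "p j \<le> (\<Sum>i\<in>{1..r}. p i)"
    using assms by (intro member_le_sum) (auto simp: prob_vector_def)
  then show ?thesis using assms by (simp add: prob_vector_def)
qed

text \<open>The second vector is frozen at \<open>q\<close>, so its displacement is 0 and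
  \<open>S\<close> is exactly the scaled differential.\<close>

lemma (in discrete_sample) one_sample_first_argument:
  assumes p_pos: "\<forall>j\<in>{1..r}. p j > 0" and q: "\<forall>j\<in>{1..r}. q j > 0"
  shows "converges_in_distribution M
         (\<lambda>n \<omega>. sqrt (real n) * (KL_div r (empirical c X n \<omega>) q - KL_div r p q))
         (normal_distribution 0 (V_KL1 r p q))"
proof -
  let ?a = "\<lambda>j. 1 + ln (p j / q j)"
  show ?thesis
  proof (rule KL_div_delta_method[where Q = "\<lambda>_ _. q" and
        S = "\<lambda>n \<omega>. sqrt (real n) * wsum r ?a (empirical c X n \<omega>) p"])
    have "filterlim (\<lambda>k::nat. k) at_top sequentially" by (rule filterlim_ident)
    from scaled_empirical_sq_dist_tendsto_0[OF this tendsto_const, of 1]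
    show "(\<lambda>k. (1 + sqrt (real k)) * expectation (\<lambda>\<omega>. \<Sum>j\<in>{1..r}.
        (empirical c X k \<omega> j - p j)\<^sup>2 + (q j - q j)\<^sup>2)) \<longlonglongrightarrow> 0"
      by simp
    show "real_distribution (normal_distribution 0 (V_KL1 r p q))"
      unfolding V_KL1_eq_mvar by (intro real_distribution_normal_distribution mvar_nonneg p)
    show "(\<lambda>n. char (distr M borel (\<lambda>\<omega>. sqrt (real n) * wsum r ?a (empirical c X n \<omega>) p)) t)
        \<longlonglongrightarrow> char (normal_distribution 0 (V_KL1 r p q)) t" for t
      unfolding V_KL1_eq_mvar by (rule char_wsum_empirical)
  qed (use p_pos q prob_vector_le_1[OF p] in
      \<open>auto simp: wsum_self empirical_nonneg integrable_empirical_square\<close>)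
qed

text \<open>The sampled law of the locale is still called \<open>p\<close> but now stands in the
  second argument, so the names are exchanged with respect to the final theorem.\<close>

lemma (in discrete_sample) one_sample_second_argument:
  assumes q: "prob_vector r q" "\<forall>j\<in>{1..r}. q j > 0" and p_pos: "\<forall>j\<in>{1..r}. p j > 0"
  shows "converges_in_distribution M
         (\<lambda>n \<omega>. sqrt (real n) * (KL_div r q (empirical c X n \<omega>) - KL_div r q p))
         (normal_distribution 0 (V_KL2 r q p))"
proof -
  let ?b = "\<lambda>j. - (q j / p j)"
  have V: "V_KL2 r q p = mvar r p ?b" by (rule V_KL2_eq_mvar[OF p_pos])
  show ?thesis
  proof (rule KL_div_delta_method[where P = "\<lambda>_ _. q" and
        S = "\<lambda>n \<omega>. sqrt (real n) * wsum r ?b (empirical c X n \<omega>) p"])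
    have "filterlim (\<lambda>k::nat. k) at_top sequentially" by (rule filterlim_ident)
    from scaled_empirical_sq_dist_tendsto_0[OF this tendsto_const, of 1]
    show "(\<lambda>k. (1 + sqrt (real k)) * expectation (\<lambda>\<omega>. \<Sum>j\<in>{1..r}.
        (q j - q j)\<^sup>2 + (empirical c X k \<omega> j - p j)\<^sup>2)) \<longlonglongrightarrow> 0"
      by simp
    show "real_distribution (normal_distribution 0 (V_KL2 r q p))"
      unfolding V by (intro real_distribution_normal_distribution mvar_nonneg p)
    show "(\<lambda>n. char (distr M borel (\<lambda>\<omega>. sqrt (real n) * wsum r ?b (empirical c X n \<omega>) p)) t)
        \<longlonglongrightarrow> char (normal_distribution 0 (V_KL2 r q p)) t" for t
      unfolding V by (rule char_wsum_empirical)
  qed (use p_pos q prob_vector_le_1[OF q(1)] in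
      \<open>auto simp: wsum_self integrable_empirical_square prob_vector_def\<close>)
qed

section \<open>Two independent samples\<close>

lemma (in prob_space) indep_var_wsum_empirical:
  assumes "indep_samples M r c X Y"
  shows "indep_var borel (\<lambda>\<omega>. wsum r a (empirical c X n \<omega>) p)
    borel (\<lambda>\<omega>. wsum r b (empirical c Y m \<omega>) q)"
proof -
  \<comment> \<open>\<open>F\<close> reads the linear term off a bare sequence of outcomes, viewed
    as random variables on the one-point space. As a measurable function on the product space it
    transfers independence from the whole samples to the two statistics.\<close>
  define F where "F a n p x = wsum r a (empirical c (\<lambda>i _. x i) n ()) p"
    for a n p and x :: "nat \<Rightarrow> 'b"
  have F_meas: "F a n p \<in> borel_measurable (\<Pi>\<^sub>M i\<in>{1..}. count_space (c ` {1..r}))" for a n p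
  proof -
    have "(\<lambda>x. of_bool (x i = c j) :: real) \<in> borel_measurable (\<Pi>\<^sub>M i\<in>{1..}. count_space (c ` {1..r}))"
      if "i \<in> {1..n}" for i j
      by (rule measurable_compose[OF measurable_component_singleton]) (use that in auto)
    then show ?thesis
      unfolding F_def wsum_def empirical_def
      by (intro borel_measurable_sum borel_measurable_times borel_measurable_diff borel_measurable_const)
  qed
  have "F a n p (\<lambda>i\<in>{1..}. Z i \<omega>) = wsum r a (empirical c Z n \<omega>) p" for a n p \<omega> and Z :: "nat \<Rightarrow> 'a \<Rightarrow> 'b"
    by (simp add: F_def wsum_def empirical_def)
  then show ?thesis
    using indep_var_compose[OF _ F_meas F_meas, of "\<lambda>\<omega>. \<lambda>i\<in>{1..}. X i \<omega>" "\<lambda>\<omega>. \<lambda>i\<in>{1..}. Y i \<omega>" a n p b m q] assms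
    by (simp add: indep_samples_def comp_def)
qed

text \<open>Writing the same scale in two ways normalizes each linear term by the square root of its
  own sample size. The limit variances are then weighted by the squares of the limiting coefficients
  and add by independence. The joint limit is taken along arbitrary sequences of pairs
  \<open>(n k, m k)\<close>.\<close>

lemma (in prob_space) two_samples:
  fixes n m :: "nat \<Rightarrow> nat" and \<alpha> \<beta> s :: "nat \<Rightarrow> real"
  assumes X: "discrete_sample M r c p X" and Y: "discrete_sample M r c q Y"
    and indep: "indep_samples M r c X Y"
    and p_pos: "\<forall>j\<in>{1..r}. p j > 0" and q_pos: "\<forall>j\<in>{1..r}. q j > 0"
    and n: "filterlim n at_top sequentially" and m: "filterlim m at_top sequentially"
    and \<alpha>: "\<alpha> \<longlonglongrightarrow> \<alpha>'" and \<beta>: "\<beta> \<longlonglongrightarrow> \<beta>'"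
    and s\<alpha>: "\<And>k. s k = \<alpha> k * sqrt (real (n k))" and s\<beta>: "\<And>k. s k = \<beta> k * sqrt (real (m k))"
    and s: "\<And>k. s k \<ge> 0"
  shows "converges_in_distribution M
     (\<lambda>k \<omega>. s k * (KL_div r (empirical c X (n k) \<omega>) (empirical c Y (m k) \<omega>) - KL_div r p q))
     (normal_distribution 0 (\<alpha>'\<^sup>2 * V_KL1 r p q + \<beta>'\<^sup>2 * V_KL2 r p q))"
proof -
  interpret P: discrete_sample M r c p X by fact
  interpret Q: discrete_sample M r c q Y by fact
  let ?a = "\<lambda>j. 1 + ln (p j / q j)" and ?b = "\<lambda>j. - (p j / q j)"
  define V1 where "V1 = V_KL1 r p q"
  define V2 where "V2 = V_KL2 r p q"
  have V1: "V1 = mvar r p ?a" unfolding V1_def by (rule V_KL1_eq_mvar)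
  have V2: "V2 = mvar r q ?b" unfolding V2_def by (rule V_KL2_eq_mvar[OF q_pos])
  have V_nonneg: "V1 \<ge> 0" "V2 \<ge> 0"
    unfolding V1 V2 by (rule mvar_nonneg[OF P.p], rule mvar_nonneg[OF Q.p])
  define v where "v = \<alpha>'\<^sup>2 * V1 + \<beta>'\<^sup>2 * V2"
  have v: "v \<ge> 0" unfolding v_def using V_nonneg by simp
  define A where "A k \<omega> = sqrt (real (n k)) * wsum r ?a (empirical c X (n k) \<omega>) p" for k \<omega>
  define B where "B k \<omega> = sqrt (real (m k)) * wsum r ?b (empirical c Y (m k) \<omega>) q" for k \<omega>
  have iA: "integrable M (A k)" and iB: "integrable M (B k)" for k
    unfolding A_def[abs_def] B_def[abs_def]
    by (intro integrable_mult_right P.integrable_wsum_empirical Q.integrable_wsum_empirical)+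
  have [measurable]: "A k \<in> borel_measurable M" "B k \<in> borel_measurable M" for k
    using iA iB by (auto intro: borel_measurable_integrable)
  \<comment> \<open>What the delta method must see vanish in mean involves only the errors of the
    coefficients \<alpha> and \<beta>.\<close>
  have linear: "s k * (wsum r ?a (empirical c X (n k) \<omega>) p + wsum r ?b (empirical c Y (m k) \<omega>) q)
      - (\<alpha>' * A k \<omega> + \<beta>' * B k \<omega>) = (\<alpha> k - \<alpha>') * A k \<omega> + (\<beta> k - \<beta>') * B k \<omega>" for k \<omega>
  proof -
    have "s k * wsum r ?a (empirical c X (n k) \<omega>) p = \<alpha> k * A k \<omega>"
      unfolding s\<alpha> A_def by simp
    moreover have "s k * wsum r ?b (empirical c Y (m k) \<omega>) q = \<beta> k * B k \<omega>"
      unfolding s\<beta> B_def by simp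
    ultimately show ?thesis by (simp add: algebra_simps)
  qed
  have "converges_in_distribution M
     (\<lambda>k \<omega>. s k * (KL_div r (empirical c X (n k) \<omega>) (empirical c Y (m k) \<omega>) - KL_div r p q))
     (normal_distribution 0 v)"
  proof (rule KL_div_delta_method[where S = "\<lambda>k \<omega>. \<alpha>' * A k \<omega> + \<beta>' * B k \<omega>"], unfold linear)
    show "0 < p j \<and> p j \<le> 1" if "j \<in> {1..r}" for j
      using p_pos prob_vector_le_1[OF P.p] that by auto
    show "0 < q j" if "j \<in> {1..r}" for j using q_pos that by auto
    show "real_distribution (normal_distribution 0 v)"
      by (rule real_distribution_normal_distribution[OF v])
    have "expectation (\<lambda>\<omega>. \<Sum>j\<in>{1..r}. (empirical c X (n k) \<omega> j - p j)\<^sup>2 + (empirical c Y (m k) \<omega> j - q j)\<^sup>2)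
      = expectation (\<lambda>\<omega>. \<Sum>j\<in>{1..r}. (empirical c X (n k) \<omega> j - p j)\<^sup>2)
        + expectation (\<lambda>\<omega>. \<Sum>j\<in>{1..r}. (empirical c Y (m k) \<omega> j - q j)\<^sup>2)" for k
      unfolding sum.distrib
      by (intro Bochner_Integration.integral_add Bochner_Integration.integrable_sum
          P.integrable_empirical_square Q.integrable_empirical_square)
    then show "(\<lambda>k. (1 + s k) * expectation (\<lambda>\<omega>. \<Sum>j\<in>{1..r}.
        (empirical c X (n k) \<omega> j - p j)\<^sup>2 + (empirical c Y (m k) \<omega> j - q j)\<^sup>2)) \<longlonglongrightarrow> 0"
      using tendsto_add[OF P.scaled_empirical_sq_dist_tendsto_0[OF n \<alpha>]
          Q.scaled_empirical_sq_dist_tendsto_0[OF m \<beta>]]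
      unfolding s\<alpha>[symmetric] s\<beta>[symmetric] by (simp add: distrib_left)
    show "integrable M (\<lambda>\<omega>. (\<alpha> k - \<alpha>') * A k \<omega> + (\<beta> k - \<beta>') * B k \<omega>)" for k
      by (intro Bochner_Integration.integrable_add integrable_mult_right iA iB)
    have bound: "expectation (\<lambda>\<omega>. \<bar>(\<alpha> k - \<alpha>') * A k \<omega> + (\<beta> k - \<beta>') * B k \<omega>\<bar>)
      \<le> \<bar>\<alpha> k - \<alpha>'\<bar> * (1 + V1) + \<bar>\<beta> k - \<beta>'\<bar> * (1 + V2)" for k
    proof -
      have "expectation (\<lambda>\<omega>. \<bar>(\<alpha> k - \<alpha>') * A k \<omega> + (\<beta> k - \<beta>') * B k \<omega>\<bar>)
        \<le> expectation (\<lambda>\<omega>. \<bar>\<alpha> k - \<alpha>'\<bar> * \<bar>A k \<omega>\<bar> + \<bar>\<beta> k - \<beta>'\<bar> * \<bar>B k \<omega>\<bar>)"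
      proof (rule integral_mono)
        show "integrable M (\<lambda>\<omega>. \<bar>(\<alpha> k - \<alpha>') * A k \<omega> + (\<beta> k - \<beta>') * B k \<omega>\<bar>)"
          "integrable M (\<lambda>\<omega>. \<bar>\<alpha> k - \<alpha>'\<bar> * \<bar>A k \<omega>\<bar> + \<bar>\<beta> k - \<beta>'\<bar> * \<bar>B k \<omega>\<bar>)"
          by (intro integrable_abs Bochner_Integration.integrable_add integrable_mult_right iA iB)+
        show "\<bar>(\<alpha> k - \<alpha>') * A k \<omega> + (\<beta> k - \<beta>') * B k \<omega>\<bar>
          \<le> \<bar>\<alpha> k - \<alpha>'\<bar> * \<bar>A k \<omega>\<bar> + \<bar>\<beta> k - \<beta>'\<bar> * \<bar>B k \<omega>\<bar>" for \<omega>
          unfolding abs_mult[symmetric] by (rule abs_triangle_ineq)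
      qed
      also have "\<dots> = \<bar>\<alpha> k - \<alpha>'\<bar> * expectation (\<lambda>\<omega>. \<bar>A k \<omega>\<bar>) + \<bar>\<beta> k - \<beta>'\<bar> * expectation (\<lambda>\<omega>. \<bar>B k \<omega>\<bar>)"
        using iA iB by simp
      also have "\<dots> \<le> \<bar>\<alpha> k - \<alpha>'\<bar> * (1 + V1) + \<bar>\<beta> k - \<beta>'\<bar> * (1 + V2)"
        unfolding A_def B_def V1 V2
        by (intro add_mono mult_left_mono P.expectation_abs_scaled_wsum_le Q.expectation_abs_scaled_wsum_le) auto
      finally show ?thesis .
    qed
    show "(\<lambda>k. expectation (\<lambda>\<omega>. \<bar>(\<alpha> k - \<alpha>') * A k \<omega> + (\<beta> k - \<beta>') * B k \<omega>\<bar>)) \<longlonglongrightarrow> 0"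
    proof (rule tendsto_sandwich[OF _ _ tendsto_const])
      show "\<forall>\<^sub>F k in sequentially. 0 \<le> expectation (\<lambda>\<omega>. \<bar>(\<alpha> k - \<alpha>') * A k \<omega> + (\<beta> k - \<beta>') * B k \<omega>\<bar>)"
        by (intro always_eventually allI Bochner_Integration.integral_nonneg) auto
      show "\<forall>\<^sub>F k in sequentially. expectation (\<lambda>\<omega>. \<bar>(\<alpha> k - \<alpha>') * A k \<omega> + (\<beta> k - \<beta>') * B k \<omega>\<bar>)
        \<le> \<bar>\<alpha> k - \<alpha>'\<bar> * (1 + V1) + \<bar>\<beta> k - \<beta>'\<bar> * (1 + V2)"
        by (intro always_eventually allI bound)
      have "(\<lambda>k. \<bar>\<alpha> k - \<alpha>'\<bar> * (1 + V1) + \<bar>\<beta> k - \<beta>'\<bar> * (1 + V2))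
          \<longlonglongrightarrow> \<bar>\<alpha>' - \<alpha>'\<bar> * (1 + V1) + \<bar>\<beta>' - \<beta>'\<bar> * (1 + V2)"
        by (intro tendsto_intros \<alpha> \<beta>)
      then show "(\<lambda>k. \<bar>\<alpha> k - \<alpha>'\<bar> * (1 + V1) + \<bar>\<beta> k - \<beta>'\<bar> * (1 + V2)) \<longlonglongrightarrow> 0" by simp
    qed
    show "(\<lambda>k. char (distr M borel (\<lambda>\<omega>. \<alpha>' * A k \<omega> + \<beta>' * B k \<omega>)) t)
        \<longlonglongrightarrow> char (normal_distribution 0 v) t" for t
    proof -
      have eq: "char (distr M borel (\<lambda>\<omega>. \<alpha>' * A k \<omega> + \<beta>' * B k \<omega>)) t
        = char (distr M borel (A k)) (\<alpha>' * t) * char (distr M borel (B k)) (\<beta>' * t)" for k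
      proof -
        have "indep_var borel ((\<lambda>x. \<alpha>' * (sqrt (real (n k)) * x)) \<circ> (\<lambda>\<omega>. wsum r ?a (empirical c X (n k) \<omega>) p))
          borel ((\<lambda>x. \<beta>' * (sqrt (real (m k)) * x)) \<circ> (\<lambda>\<omega>. wsum r ?b (empirical c Y (m k) \<omega>) q))"
          by (rule indep_var_compose[OF indep_var_wsum_empirical[OF indep]]) measurable
        then have "indep_var borel (\<lambda>\<omega>. \<alpha>' * A k \<omega>) borel (\<lambda>\<omega>. \<beta>' * B k \<omega>)"
          by (simp add: comp_def A_def B_def)
        then have "char (distr M borel (\<lambda>\<omega>. \<alpha>' * A k \<omega> + \<beta>' * B k \<omega>)) t
          = char (distr M borel (\<lambda>\<omega>. \<alpha>' * A k \<omega>)) t * char (distr M borel (\<lambda>\<omega>. \<beta>' * B k \<omega>)) t"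
          by (rule char_distr_add)
        then show ?thesis by (simp only: char_distr_scale \<open>A k \<in> _\<close> \<open>B k \<in> _\<close>)
      qed
      have "(\<lambda>k. char (distr M borel (A k)) (\<alpha>' * t)) \<longlonglongrightarrow> char (normal_distribution 0 V1) (\<alpha>' * t)"
        unfolding A_def V1 by (rule filterlim_compose[OF P.char_wsum_empirical n])
      moreover have "(\<lambda>k. char (distr M borel (B k)) (\<beta>' * t)) \<longlonglongrightarrow> char (normal_distribution 0 V2) (\<beta>' * t)"
        unfolding B_def V2 by (rule filterlim_compose[OF Q.char_wsum_empirical m])
      ultimately have "(\<lambda>k. char (distr M borel (\<lambda>\<omega>. \<alpha>' * A k \<omega> + \<beta>' * B k \<omega>)) t)
        \<longlonglongrightarrow> char (normal_distribution 0 V1) (\<alpha>' * t) * char (normal_distribution 0 V2) (\<beta>' * t)"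
        unfolding eq by (rule tendsto_mult)
      also have "char (normal_distribution 0 V1) (\<alpha>' * t) * char (normal_distribution 0 V2) (\<beta>' * t)
        = of_real (exp (- (V1 * (\<alpha>' * t)\<^sup>2) / 2 + - (V2 * (\<beta>' * t)\<^sup>2) / 2))"
        unfolding char_normal_distribution[OF V_nonneg(1)] char_normal_distribution[OF V_nonneg(2)]
        by (simp only: exp_add of_real_mult)
      also have "- (V1 * (\<alpha>' * t)\<^sup>2) / 2 + - (V2 * (\<beta>' * t)\<^sup>2) / 2 = - (v * t\<^sup>2) / 2"
        by (simp add: v_def field_simps power_mult_distrib)
      also have "of_real (exp (- (v * t\<^sup>2) / 2)) = char (normal_distribution 0 v) t"
        by (rule char_normal_distribution[OF v, symmetric])
      finally show ?thesis .
    qed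
  qed (simp_all add: s empirical_nonneg P.integrable_empirical_square Q.integrable_empirical_square)
  then show ?thesis by (simp only: v_def V1_def V2_def)
qed

theorem corollary10:
  fixes M :: "'w measure" and r :: nat and c :: "nat \<Rightarrow> 'a"
    and p q :: "nat \<Rightarrow> real" and X Y :: "nat \<Rightarrow> 'w \<Rightarrow> 'a"
  assumes "prob_space M"
    and "r \<ge> 2"
    and "inj_on c {1..r}"
    and "prob_vector r p" and "\<forall>j\<in>{1..r}. p j > 0"
    and "prob_vector r q" and "\<forall>j\<in>{1..r}. q j > 0"
    and "iid_sample M r c p X"
    and "iid_sample M r c q Y"
    and "indep_samples M r c X Y"
  shows "converges_in_distribution M
         (\<lambda>n \<omega>. sqrt (real n) * (KL_div r (empirical c X n \<omega>) q - KL_div r p q))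
         (normal_distribution 0 (V_KL1 r p q)) \<and>
    converges_in_distribution M
         (\<lambda>n \<omega>. sqrt (real n) * (KL_div r p (empirical c Y n \<omega>) - KL_div r p q))
         (normal_distribution 0 (V_KL2 r p q)) \<and>
    (\<forall>(n :: nat \<Rightarrow> nat) (m :: nat \<Rightarrow> nat) \<gamma>::real.
         filterlim n at_top sequentially \<longrightarrow> filterlim m at_top sequentially \<longrightarrow>
         0 < \<gamma> \<longrightarrow> \<gamma> < 1 \<longrightarrow>
         (\<lambda>k. real (n k) * real (m k) / (real (n k) + real (m k))) \<longlonglongrightarrow> \<gamma> \<longrightarrow>
         converges_in_distribution M
           (\<lambda>k \<omega>. sqrt (real (m k) * real (n k) /
                       (real (n k) * V_KL2 r p q + real (m k) * V_KL1 r p q)) *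
                  (KL_div r (empirical c X (n k) \<omega>) (empirical c Y (m k) \<omega>) - KL_div r p q))
           (normal_distribution 0 1)) \<and>
    ((\<exists>j\<in>{1..r}. p j \<noteq> q j) \<longrightarrow>
       (\<forall>(n :: nat \<Rightarrow> nat) (m :: nat \<Rightarrow> nat) \<gamma>::real.
         filterlim n at_top sequentially \<longrightarrow> filterlim m at_top sequentially \<longrightarrow>
         0 < \<gamma> \<longrightarrow> \<gamma> < 1 \<longrightarrow>
         (\<lambda>k. real (n k) / (real (n k) + real (m k))) \<longlonglongrightarrow> \<gamma> \<longrightarrow>
         converges_in_distribution M
           (\<lambda>k \<omega>. sqrt (real (m k) * real (n k) /
                       (real (n k) * V_KL2 r p q + real (m k) * V_KL1 r p q)) *
                  (KL_div r (empirical c X (n k) \<omega>) (empirical c Y (m k) \<omega>) - KL_div r p q))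
           (normal_distribution 0 1)))"
proof -
  interpret P: discrete_sample M r c p X
    using assms by (simp add: discrete_sample_def discrete_sample_axioms_def)
  interpret Q: discrete_sample M r c q Y
    using assms by (simp add: discrete_sample_def discrete_sample_axioms_def)
  have reciprocals: "(\<lambda>k. inverse (real (n k)) + inverse (real (m k))) \<longlonglongrightarrow> 0"
    if "filterlim n at_top sequentially" "filterlim m at_top sequentially" for n m :: "nat \<Rightarrow> nat"
    using tendsto_add[OF
        tendsto_inverse_0_at_top[OF filterlim_compose[OF filterlim_real_sequentially that(1)]]
        tendsto_inverse_0_at_top[OF filterlim_compose[OF filterlim_real_sequentially that(2)]]]
    by simp
  \<comment> \<open>\<open>n m / (n + m)\<close> is the reciprocal of \<open>1 / n + 1 / m\<close>, hence cannot have a finite limit.\<close>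
  have no_limit: False
    if nm: "filterlim n at_top sequentially" "filterlim m at_top sequentially" and "0 < \<gamma>"
      and lim: "(\<lambda>k. real (n k) * real (m k) / (real (n k) + real (m k))) \<longlonglongrightarrow> \<gamma>"
    for n m :: "nat \<Rightarrow> nat" and \<gamma> :: real
  proof -
    have "eventually (\<lambda>k. n k \<ge> 1) sequentially" "eventually (\<lambda>k. m k \<ge> 1) sequentially"
      using nm by (simp_all add: filterlim_at_top)
    then have "eventually (\<lambda>k. inverse (real (n k) * real (m k) / (real (n k) + real (m k)))
        = inverse (real (n k)) + inverse (real (m k))) sequentially"
      by eventually_elim (simp add: field_simps)
    moreover have "(\<lambda>k. inverse (real (n k) * real (m k) / (real (n k) + real (m k)))) \<longlonglongrightarrow> inverse \<gamma>"
      using lim \<open>0 < \<gamma>\<close> by (intro tendsto_inverse) auto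
    ultimately have "(\<lambda>k. inverse (real (n k)) + inverse (real (m k))) \<longlonglongrightarrow> inverse \<gamma>"
      by (rule Lim_transform_eventually[rotated])
    then have "inverse \<gamma> = 0" using reciprocals[OF nm] by (rule LIMSEQ_unique)
    then show False using \<open>0 < \<gamma>\<close> by simp
  qed
  have two_sample_limit: "converges_in_distribution M
           (\<lambda>k \<omega>. sqrt (real (m k) * real (n k) /
                       (real (n k) * V_KL2 r p q + real (m k) * V_KL1 r p q)) *
                  (KL_div r (empirical c X (n k) \<omega>) (empirical c Y (m k) \<omega>) - KL_div r p q))
           (normal_distribution 0 1)"
    if ne: "\<exists>j\<in>{1..r}. p j \<noteq> q j"
      and n: "filterlim n at_top sequentially" and m: "filterlim m at_top sequentially"
      and \<gamma>: "0 < \<gamma>" "\<gamma> < 1"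
      and lim: "(\<lambda>k. real (n k) / (real (n k) + real (m k))) \<longlonglongrightarrow> \<gamma>"
    for n m :: "nat \<Rightarrow> nat" and \<gamma> :: real
  proof -
    define V1 where "V1 = V_KL1 r p q"
    define V2 where "V2 = V_KL2 r p q"
    \<comment> \<open>This is where \<open>p \<noteq> q\<close> enters: for \<open>p = q\<close>
      both variances, and with them \<open>D k\<close>, would be 0.\<close>
    have V1: "V1 > 0" unfolding V1_def by (rule V_KL1_pos[OF assms(4,6,5,7) ne])
    have V2: "V2 > 0" unfolding V2_def by (rule V_KL2_pos[OF assms(4,6,7) ne])
    define D where "D k = real (n k) * V2 + real (m k) * V1" for k
    define g where "g k = real (n k) / (real (n k) + real (m k))" for k
    \<comment> \<open>\<open>d\<close> is the limit of \<open>D k / (n k + m k)\<close>. The squares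
      of the two coefficients of the scale are \<open>m k / D k\<close> and
      \<open>n k / D k\<close>, with limits \<open>(1 - \<gamma>) / d\<close> and
      \<open>\<gamma> / d\<close>.\<close>
    define d where "d = \<gamma> * V2 + (1 - \<gamma>) * V1"
    have d: "d > 0" unfolding d_def using \<gamma> V1 V2 by (intro add_pos_pos mult_pos_pos) auto
    have g: "g \<longlonglongrightarrow> \<gamma>" using lim by (simp add: g_def[abs_def])
    have "eventually (\<lambda>k. n k \<ge> 1) sequentially" using n by (simp add: filterlim_at_top)
    \<comment> \<open>Dividing by \<open>n k + m k\<close> expresses both quotients through
      \<open>g k\<close>, whose limit is given; \<open>n k \<ge> 1\<close> keeps this divisor
      positive.\<close>
    then have ratios: "eventually (\<lambda>k. (1 - g k) / (g k * V2 + (1 - g k) * V1) = real (m k) / D k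
        \<and> g k / (g k * V2 + (1 - g k) * V1) = real (n k) / D k) sequentially"
    proof eventually_elim
      case (elim k)
      define N where "N = real (n k) + real (m k)"
      have N: "N > 0" using elim by (simp add: N_def)
      have g1: "g k = real (n k) / N" by (simp add: g_def N_def)
      have g2: "1 - g k = real (m k) / N" using N unfolding g1 by (simp add: field_simps) (simp add: N_def)
      have "g k * V2 + (1 - g k) * V1 = D k / N"
        unfolding g2 unfolding g1 by (simp add: D_def add_divide_distrib)
      then show ?case unfolding g2 using N by (simp add: g1)
    qed
    have denominator: "(\<lambda>k. g k * V2 + (1 - g k) * V1) \<longlonglongrightarrow> d"
      unfolding d_def by (intro tendsto_intros g)
    have "(\<lambda>k. (1 - g k) / (g k * V2 + (1 - g k) * V1)) \<longlonglongrightarrow> (1 - \<gamma>) / d"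
      using d by (intro tendsto_divide tendsto_diff tendsto_const g denominator) auto
    then have "(\<lambda>k. real (m k) / D k) \<longlonglongrightarrow> (1 - \<gamma>) / d"
      by (rule Lim_transform_eventually) (use ratios in \<open>auto elim: eventually_mono\<close>)
    then have \<alpha>: "(\<lambda>k. sqrt (real (m k) / D k)) \<longlonglongrightarrow> sqrt ((1 - \<gamma>) / d)"
      by (rule tendsto_real_sqrt)
    have "(\<lambda>k. g k / (g k * V2 + (1 - g k) * V1)) \<longlonglongrightarrow> \<gamma> / d"
      using d by (intro tendsto_divide g denominator) auto
    then have "(\<lambda>k. real (n k) / D k) \<longlonglongrightarrow> \<gamma> / d"
      by (rule Lim_transform_eventually) (use ratios in \<open>auto elim: eventually_mono\<close>)
    then have \<beta>: "(\<lambda>k. sqrt (real (n k) / D k)) \<longlonglongrightarrow> sqrt (\<gamma> / d)"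
      by (rule tendsto_real_sqrt)
    have "converges_in_distribution M
        (\<lambda>k \<omega>. sqrt (real (m k) * real (n k) / D k) *
          (KL_div r (empirical c X (n k) \<omega>) (empirical c Y (m k) \<omega>) - KL_div r p q))
        (normal_distribution 0 ((sqrt ((1 - \<gamma>) / d))\<^sup>2 * V_KL1 r p q + (sqrt (\<gamma> / d))\<^sup>2 * V_KL2 r p q))"
    proof (rule P.two_samples[OF _ _ assms(10,5,7) n m \<alpha> \<beta>])
      show "sqrt (real (m k) * real (n k) / D k) = sqrt (real (m k) / D k) * sqrt (real (n k))" for k
        by (simp flip: real_sqrt_mult)
      show "sqrt (real (m k) * real (n k) / D k) = sqrt (real (n k) / D k) * sqrt (real (m k))" for k
        by (simp add: mult.commute flip: real_sqrt_mult)
      show "0 \<le> sqrt (real (m k) * real (n k) / D k)" for k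
        using V1 V2 by (simp add: D_def)
    qed (rule P.discrete_sample_axioms, rule Q.discrete_sample_axioms)
    \<comment> \<open>The limit variance is \<open>d / d\<close>: the prescribed normalization is
      the one that standardizes the Gaussian limit.\<close>
    moreover have "(sqrt ((1 - \<gamma>) / d))\<^sup>2 * V1 + (sqrt (\<gamma> / d))\<^sup>2 * V2 = 1"
    proof -
      have "(sqrt ((1 - \<gamma>) / d))\<^sup>2 * V1 + (sqrt (\<gamma> / d))\<^sup>2 * V2 = (1 - \<gamma>) / d * V1 + \<gamma> / d * V2"
        using \<gamma> d by simp
      also have "\<dots> = (\<gamma> * V2 + (1 - \<gamma>) * V1) / d" by (simp add: add_divide_distrib)
      also have "\<dots> = 1" using d by (simp flip: d_def)
      finally show ?thesis .
    qed
    ultimately show ?thesis by (simp only: D_def V1_def V2_def)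
  qed
  show ?thesis
    using P.one_sample_first_argument[OF assms(5,7)]
      Q.one_sample_second_argument[OF assms(4,5,7)] no_limit two_sample_limit
    by blast
qed

end
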